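(* Let the random walk $(S_n)_{n\ge 0}$ in $\mathbb{Z}^d$, $d\ge 1$, be transient, and let $f:\mathbb{Z}^+\to\mathbb{R}$ be a function satisfying $$\sum_{j=1}^\infty f^2(j)\,j\,(1-\gamma)^j<\infty .$$ Then $$\frac{G_n(f)}{n}\ \to\ \gamma^2\sum_{j=1}^\infty f(j)(1-\gamma)^{j-1}\qquad\text{as } n\to\infty$$ in mean square and with probability $1$.
   Context: $X_1,X_2,\ldots$ are independent identically distributed random vectors with values in $\mathbb{Z}^d$, $d\ge 1$; $S_0:=0$ and $S_n:=X_1+\cdots+X_n$. Put $\gamma:=\mathbb{P}\{S_n\ne 0\text{ for all } n\ge 1\}$; the walk is transient if $\gamma>0$, and it is assumed throughout that also $\gamma<1$. The local time of $x\in\mathbb{Z}^d$ up to time $n$ is $l(n,x):=\sum_{i=0}^n \mathbf{1}\{S_i=x\}$. For a function $f:\mathbb{Z}^+\to\mathbb{R}$, $G_n(f):=\sum_{x\in\mathbb{Z}^d} f(l(n,x))$, where only visited sites are counted, that is, $G_n(f)=\sum_{j\ge 1} f(j)Q_n(j)$ with $Q_n(j)$ the number of sites $x$ such that $l(n,x)=j$. *)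

theory Defs
  imports "HOL-Probability.Probability"
begin

text \<open>
  The lattice \<open>\<int>\<^sup>d\<close> is the type \<open>int ^ 'd\<close> with \<open>'d :: finite\<close>, carrying the discrete
  sigma-algebra; \<open>d = CARD('d) \<ge> 1\<close> is arbitrary. The steps are \<open>X 1, X 2, \<dots>\<close>; the value of
  \<open>X 0\<close> is never used.
\<close>

definition iid_steps :: "'a measure \<Rightarrow> (nat \<Rightarrow> 'a \<Rightarrow> int ^ 'd) \<Rightarrow> bool" where
  "iid_steps M X \<longleftrightarrow>
     prob_space.indep_vars M (\<lambda>_. count_space UNIV) X {1..} \<and>
     (\<forall>i\<ge>1. distr M (count_space UNIV) (X i) = distr M (count_space UNIV) (X 1))"

definition walk :: "(nat \<Rightarrow> 'a \<Rightarrow> int ^ 'd) \<Rightarrow> nat \<Rightarrow> 'a \<Rightarrow> int ^ 'd" where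
  "walk X n \<omega> = (\<Sum>i=1..n. X i \<omega>)"

definition escape_prob :: "'a measure \<Rightarrow> (nat \<Rightarrow> 'a \<Rightarrow> int ^ 'd) \<Rightarrow> real" where
  "escape_prob M X = measure M {\<omega> \<in> space M. \<forall>n\<ge>1. walk X n \<omega> \<noteq> 0}"

definition transient :: "'a measure \<Rightarrow> (nat \<Rightarrow> 'a \<Rightarrow> int ^ 'd) \<Rightarrow> bool" where
  "transient M X \<longleftrightarrow> escape_prob M X > 0"

definition local_time :: "(nat \<Rightarrow> 'a \<Rightarrow> int ^ 'd) \<Rightarrow> nat \<Rightarrow> int ^ 'd \<Rightarrow> 'a \<Rightarrow> nat" where
  "local_time X n x \<omega> = (\<Sum>i=0..n. of_bool (walk X i \<omega> = x))"

text \<open>Only visited sites are counted, so \<open>f 0\<close> plays no role.\<close>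

definition G :: "(nat \<Rightarrow> 'a \<Rightarrow> int ^ 'd) \<Rightarrow> (nat \<Rightarrow> real) \<Rightarrow> nat \<Rightarrow> 'a \<Rightarrow> real" where
  "G X f n \<omega> = (\<Sum>x | local_time X n x \<omega> \<ge> 1. f (local_time X n x \<omega>))"

lemma visited_sites: "{x. local_time X n x \<omega> \<ge> 1} = (\<lambda>i. walk X i \<omega>) ` {0..n}"
  by (auto simp: local_time_def Suc_le_eq card_gt_0_iff)

lemma finite_visited_sites: "finite {x. local_time X n x \<omega> \<ge> 1}"
  unfolding visited_sites by simp

lemma local_time_le: "local_time X n x \<omega> \<le> Suc n"
  unfolding local_time_def
  by (rule order_trans[OF sum_bounded_above[where K = 1]]) auto

lemma G_eq_sum_Q: "G X f n \<omega> = (\<Sum>j=1..Suc n. f j * real (card {x. local_time X n x \<omega> = j}))"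
proof -
  let ?l = "\<lambda>x. local_time X n x \<omega>"
  have "G X f n \<omega> = (\<Sum>j=1..Suc n. \<Sum>x | x \<in> {x. ?l x \<ge> 1} \<and> ?l x = j. f (?l x))"
    unfolding G_def
    by (rule sum.group[symmetric]) (use finite_visited_sites local_time_le in auto)
  also have "\<dots> = (\<Sum>j=1..Suc n. f j * real (card {x. ?l x = j}))"
  proof (rule sum.cong[OF refl])
    fix j assume "j \<in> {1..Suc n}"
    then have "{x. x \<in> {x. ?l x \<ge> 1} \<and> ?l x = j} = {x. ?l x = j}" by auto
    then show "(\<Sum>x | x \<in> {x. ?l x \<ge> 1} \<and> ?l x = j. f (?l x)) = f j * real (card {x. ?l x = j})"
      by simp
  qed
  finally show ?thesis .
qed

text \<open>
  Square-integrability is part of the definition, since the Bochner integral of a non-integrable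
  function is \<open>0\<close> by convention.
\<close>

definition tendsto_mean_square :: "'a measure \<Rightarrow> (nat \<Rightarrow> 'a \<Rightarrow> real) \<Rightarrow> real \<Rightarrow> bool" where
  "tendsto_mean_square M Y c \<longleftrightarrow>
     (\<forall>n. Y n \<in> borel_measurable M \<and> integrable M (\<lambda>\<omega>. (Y n \<omega>)\<^sup>2)) \<and>
     (\<lambda>n. \<integral>\<omega>. (Y n \<omega> - c)\<^sup>2 \<partial>M) \<longlonglongrightarrow> 0"

end

theory Submission
  imports Defs "HOL-Library.Discrete_Functions"
begin

text \<open>
  Let \<open>h(k) = f(k + 1) - f(k)\<close> with \<open>f(0) = 0\<close>. Telescoping over the visits of each site, taken
  backwards in time, gives \<open>G\<^sub>n(f) = \<Sum>\<^sub>i\<^sub>\<le>\<^sub>n h(R\<^sub>i\<^sub>,\<^sub>n)\<close>, where \<open>R\<^sub>i\<^sub>,\<^sub>n\<close> is the number of returns to the site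
  \<open>S\<^sub>i\<close> in the time interval \<open>(i, n]\<close>. As \<open>n\<close> grows, \<open>R\<^sub>i\<^sub>,\<^sub>n\<close> increases to a stationary sequence of
  geometric variables. Replacing \<open>R\<^sub>i\<^sub>,\<^sub>n\<close> by the number of returns in \<open>(i, i + m]\<close> produces a bounded
  stationary sequence of finite range, which satisfies the strong law; the error is dominated by
  the stationary sequence of oscillations of \<open>h\<close> along the returns after \<open>i + m\<close>, whose mean tends
  to \<open>0\<close> with \<open>m\<close>, so the maximal ergodic inequality makes its averages uniformly small. For
  convergence in mean square, \<open>h\<close> is truncated and the Cauchy-Schwarz inequality bounds the second
  moment of the remainder.
\<close>

section \<open>Deterministic path identities: from local times to later returns\<close>

subsection \<open>Returns of a path\<close>

text \<open>Listed in decreasing order, the elements of \<open>B\<close> have 0, 1, 2, ... larger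
  elements, so each count below \<open>card B\<close> occurs exactly once. The induction adds a new
  minimum: all old elements lie above it, and their own counts do not change.\<close>

lemma sum_card_greater:
  fixes h :: "nat \<Rightarrow> 'c::comm_monoid_add" and B :: "nat set"
  assumes "finite B"
  shows "(\<Sum>i\<in>B. h (card {k\<in>B. i < k})) = (\<Sum>j<card B. h j)"
  using assms
proof (induction rule: finite_linorder_min_induct)
  case empty
  then show ?case by simp
next
  case (insert b A)
  have b: "b \<notin> A" using insert.hyps by auto
  have "{k\<in>insert b A. b < k} = A" using insert.hyps by auto
  moreover have "{k\<in>insert b A. i < k} = {k\<in>A. i < k}" if "i \<in> A" for i
    using insert.hyps that by fastforce
  ultimately show ?case using insert b by (simp add: add.commute)
qed

text \<open>Steps are indexed from 0, so entry \<open>j\<close> stands for \<open>X (Suc j)\<close>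
  and a path is a point of a product over all natural numbers.\<close>

definition psum :: "(nat \<Rightarrow> 'b::ab_group_add) \<Rightarrow> nat \<Rightarrow> 'b" where
  "psum y n = (\<Sum>i<n. y i)"

definition seq_shift :: "nat \<Rightarrow> (nat \<Rightarrow> 'b) \<Rightarrow> nat \<Rightarrow> 'b" where
  "seq_shift i y = (\<lambda>n. y (i + n))"

definition returns :: "(nat \<Rightarrow> 'b::ab_group_add) \<Rightarrow> nat \<Rightarrow> nat" where
  "returns y n = card {k\<in>{1..n}. psum y k = 0}"

text \<open>
  \<open>returns (seq_shift i y) (n - i)\<close> counts the visits to the \<open>i\<close>-th position strictly after time \<open>i\<close>
  and up to time \<open>n\<close>.
\<close>

definition future_sum :: "(nat \<Rightarrow> real) \<Rightarrow> nat \<Rightarrow> (nat \<Rightarrow> 'b::ab_group_add) \<Rightarrow> real" where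
  "future_sum h n y = (\<Sum>i\<le>n. h (returns (seq_shift i y) (n - i)))"

lemma psum_shift: "psum (seq_shift i y) k = psum y (i + k) - psum y i"
proof -
  have "psum y (i + k) = psum y i + psum (seq_shift i y) k"
    unfolding psum_def seq_shift_def by (induction k) (simp_all add: add.assoc)
  then show ?thesis by simp
qed

lemma shift_shift: "seq_shift i (seq_shift j y) = seq_shift (j + i) y"
  by (simp add: seq_shift_def add.assoc)

lemma shift_0 [simp]: "seq_shift 0 y = y"
  by (simp add: seq_shift_def)

lemma psum_cong: "(\<And>i. i < n \<Longrightarrow> y i = z i) \<Longrightarrow> psum y n = psum z n"
  by (simp add: psum_def)

lemma returns_cong: "(\<And>i. i < n \<Longrightarrow> y i = z i) \<Longrightarrow> returns y n = returns z n"
proof -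
  assume "\<And>i. i < n \<Longrightarrow> y i = z i"
  then have "psum y k = psum z k" if "k \<le> n" for k
    using that by (intro psum_cong) auto
  then have "{k\<in>{1..n}. psum y k = 0} = {k\<in>{1..n}. psum z k = 0}" by auto
  then show ?thesis by (simp add: returns_def)
qed

lemma returns_0 [simp]: "returns y 0 = 0"
  by (simp add: returns_def)

lemma returns_Suc: "returns y (Suc n) = returns y n + of_bool (psum y (Suc n) = 0)"
proof -
  have "{k\<in>{1..Suc n}. psum y k = 0}
      = {k\<in>{1..n}. psum y k = 0} \<union> {k. k = Suc n \<and> psum y k = 0}" by auto
  then have "returns y (Suc n) = returns y n + card {k. k = Suc n \<and> psum y k = 0}"
    unfolding returns_def by (simp add: card_Un_disjoint disjoint_iff)
  also have "{k. k = Suc n \<and> psum y k = 0} = (if psum y (Suc n) = 0 then {Suc n} else {})" by auto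
  finally show ?thesis by simp
qed

lemma returns_le: "returns y n \<le> n"
  by (induction n) (simp_all add: returns_Suc of_bool_def)

lemma mono_returns: "mono (returns y)"
  by (simp add: incseq_SucI returns_Suc)

lemma returns_shift:
  assumes "i \<le> n"
  shows "returns (seq_shift i y) (n - i) = card {k\<in>{i<..n}. psum y k = psum y i}"
proof -
  have "{k\<in>{i<..n}. psum y k = psum y i} = (+) i ` {k\<in>{1..n-i}. psum (seq_shift i y) k = 0}"
    (is "?L = ?R")
  proof
    show "?L \<subseteq> ?R"
    proof
      fix k assume "k \<in> ?L"
      then have "k = i + (k - i)" "k - i \<in> {k\<in>{1..n-i}. psum (seq_shift i y) k = 0}"
        by (auto simp: psum_shift)
      then show "k \<in> ?R" by blast
    qed
  qed (use assms in \<open>auto simp: psum_shift\<close>)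
  then show ?thesis by (simp add: returns_def card_image)
qed

text \<open>Times up to \<open>n\<close> are grouped by the site visited. Within the group
  \<open>B x\<close> the number of later visits runs through all values below the local time of
  \<open>x\<close>, and the increments of \<open>f\<close> over these values telescope. The
  conditional in the increment assigns the value 0 at 0, whatever \<open>f 0\<close> is.\<close>

lemma G_eq_future_sum:
  "G X f n \<omega> = future_sum (\<lambda>k. f (Suc k) - (if k = 0 then 0 else f k)) n (\<lambda>j. X (Suc j) \<omega>)"
proof -
  define y where "y = (\<lambda>j. X (Suc j) \<omega>)"
  define h where "h = (\<lambda>k. f (Suc k) - (if k = 0 then 0 else f k))"
  have walk: "walk X k \<omega> = psum y k" for k
    unfolding walk_def psum_def y_def
    by (rule sum.reindex_bij_witness[of _ Suc "\<lambda>i. i - 1"]) auto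
  define B where "B x = {i\<in>{..n}. psum y i = x}" for x
  have lt: "local_time X n x \<omega> = card (B x)" for x
    unfolding local_time_def walk B_def
    by (simp add: Int_def atLeast0AtMost)
  have tele: "(\<Sum>j<N. h j) = f N" if "N \<ge> 1" for N
    using that by (induction N rule: dec_induct) (simp_all add: h_def)
  have "future_sum h n y = (\<Sum>i\<in>{..n}. h (card {k\<in>{i<..n}. psum y k = psum y i}))"
    unfolding future_sum_def by (intro sum.cong) (auto simp: returns_shift)
  also have "\<dots> = (\<Sum>x\<in>psum y ` {..n}. \<Sum>i\<in>B x. h (card {k\<in>{i<..n}. psum y k = psum y i}))"
    unfolding B_def by (rule sum.group[symmetric]) auto
  also have "\<dots> = (\<Sum>x\<in>psum y ` {..n}. \<Sum>i\<in>B x. h (card {k\<in>B x. i < k}))"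
    by (intro sum.cong arg_cong[where f = h] arg_cong[where f = card]) (auto simp: B_def)
  also have "\<dots> = (\<Sum>x\<in>psum y ` {..n}. \<Sum>j<card (B x). h j)"
    by (intro sum.cong sum_card_greater) (auto simp: B_def)
  also have "\<dots> = (\<Sum>x\<in>psum y ` {..n}. f (card (B x)))"
  proof (intro sum.cong refl tele)
    fix x assume "x \<in> psum y ` {..n}"
    then have "B x \<noteq> {}" "finite (B x)" by (auto simp: B_def)
    then show "card (B x) \<ge> 1" by (simp add: Suc_le_eq card_gt_0_iff)
  qed
  also have "\<dots> = G X f n \<omega>"
    unfolding G_def visited_sites by (simp add: walk lt atLeast0AtMost)
  finally show ?thesis by (simp add: h_def y_def)
qed

section \<open>A covering inequality, and a strong law for finite-range dependence\<close>

subsection \<open>Averages\<close>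

text \<open>
  Greedy covering: scan from left to right, skip an index that does not start a heavy window and
  jump over the whole window otherwise.
\<close>

lemma card_heavy_windows:
  fixes a :: "nat \<Rightarrow> ennreal" and L :: ennreal
  shows "of_nat (card {i. i < N \<and> (\<exists>n<m. L * of_nat (Suc n) < (\<Sum>j<Suc n. a (i + j)))}) * L
    \<le> (\<Sum>j<N+m. a j)"
proof (induction N arbitrary: a rule: less_induct)
  case (less N)
  define D where "D a N = {i. i < N \<and> (\<exists>n<m. L * of_nat (Suc n) < (\<Sum>j<Suc n. a (i + j)))}"
    for N and a :: "nat \<Rightarrow> ennreal"
  have IH: "of_nat (card (D a' N')) * L \<le> (\<Sum>j<N'+m. a' j)" if "N' < N" for a' N'
    using less.IH[OF that] by (simp add: D_def)
  have split: "(\<Sum>j<p + r. a j) = (\<Sum>j<p. a j) + (\<Sum>j<r. a (p + j))" for p r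
    by (induction r) (simp_all add: add.assoc)
  have finD: "finite (D a N)" for a N unfolding D_def by simp
  \<comment> \<open>Heavy indices from \<open>p\<close> on are exactly those of the sequence shifted
    by \<open>p\<close>, to which the induction hypothesis applies. Below, \<open>p\<close> is 1 or
    the length of a heavy window at 0.\<close>
  have step: "card (D a N) \<le> card (D a N \<inter> {..<p}) + card (D (\<lambda>j. a (p + j)) (N - p))" for p
  proof -
    have "D a N \<subseteq> (D a N \<inter> {..<p}) \<union> (+) p ` D (\<lambda>j. a (p + j)) (N - p)"
    proof
      fix i assume i: "i \<in> D a N"
      show "i \<in> (D a N \<inter> {..<p}) \<union> (+) p ` D (\<lambda>j. a (p + j)) (N - p)"
      proof (cases "i < p")
        case False
        then have "i = p + (i - p)" "i - p \<in> D (\<lambda>j. a (p + j)) (N - p)"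
          using i by (auto simp: D_def)
        then show ?thesis by blast
      qed (use i in simp)
    qed
    then have "card (D a N)
        \<le> card ((D a N \<inter> {..<p}) \<union> (+) p ` D (\<lambda>j. a (p + j)) (N - p))"
      using finD by (intro card_mono) auto
    also have "\<dots> \<le> card (D a N \<inter> {..<p}) + card ((+) p ` D (\<lambda>j. a (p + j)) (N - p))"
      by (rule card_Un_le)
    finally show ?thesis by (simp add: card_image)
  qed
  show ?case
  proof (cases "N = 0")
    case N: False
    have "of_nat (card (D a N)) * L \<le> (\<Sum>j<N+m. a j)"
    proof (cases "0 \<in> D a N")
      case False
      then have "D a N \<inter> {..<1} = {}" by auto
      then have "card (D a N) \<le> card (D (\<lambda>j. a (1 + j)) (N - 1))" using step[of 1] by simp
      then have "of_nat (card (D a N)) * L \<le> of_nat (card (D (\<lambda>j. a (1 + j)) (N - 1))) * L"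
        by (intro mult_right_mono of_nat_mono) auto
      also have "\<dots> \<le> (\<Sum>j<N-1+m. a (1 + j))" using N by (intro IH) auto
      also have "\<dots> \<le> (\<Sum>j<1+(N-1+m). a j)" unfolding split by simp
      finally show ?thesis using N by simp
    next
      case True
      then obtain n where n: "n < m" "L * of_nat (Suc n) < (\<Sum>j<Suc n. a j)"
        by (auto simp: D_def)
      have c: "card (D a N \<inter> {..<Suc n}) \<le> Suc n"
        using card_mono[of "{..<Suc n}" "D a N \<inter> {..<Suc n}"] by simp
      \<comment> \<open>The window carries more than \<open>L\<close> per index, which pays for
        every heavy index inside it.\<close>
      have heavy: "of_nat (card (D a N \<inter> {..<Suc n})) * L \<le> (\<Sum>j<Suc n. a j)"
      proof -
        have "of_nat (card (D a N \<inter> {..<Suc n})) * L \<le> of_nat (Suc n) * L"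
          using c by (intro mult_right_mono of_nat_mono) auto
        then show ?thesis using n by (simp add: mult.commute)
      qed
      have "of_nat (card (D a N)) * L
        \<le> of_nat (card (D a N \<inter> {..<Suc n}) + card (D (\<lambda>j. a (Suc n + j)) (N - Suc n))) * L"
        by (intro mult_right_mono of_nat_mono step) auto
      also have "\<dots> = of_nat (card (D a N \<inter> {..<Suc n})) * L
          + of_nat (card (D (\<lambda>j. a (Suc n + j)) (N - Suc n))) * L"
        by (simp add: distrib_right)
      also have "\<dots> \<le> (\<Sum>j<N+m. a j)"
      \<comment> \<open>A window may run past \<open>N\<close>, but its length is at most
        \<open>m\<close>; this is why the bound sums up to \<open>N + m\<close>.\<close>
      proof (cases "N \<le> Suc n")
        case True
        have "D (\<lambda>j. a (Suc n + j)) (N - Suc n) = {}" using True by (simp add: D_def)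
        moreover have "(\<Sum>j<Suc n. a j) \<le> (\<Sum>j<N+m. a j)"
          using n by (intro sum_mono2) auto
        ultimately show ?thesis using order_trans[OF heavy] by simp
      next
        case False
        have "of_nat (card (D (\<lambda>j. a (Suc n + j)) (N - Suc n))) * L
            \<le> (\<Sum>j<N-Suc n+m. a (Suc n + j))"
          using N by (intro IH) auto
        then have "of_nat (card (D a N \<inter> {..<Suc n})) * L
          + of_nat (card (D (\<lambda>j. a (Suc n + j)) (N - Suc n))) * L
          \<le> (\<Sum>j<Suc n + (N-Suc n+m). a j)"
          unfolding split by (intro add_mono heavy)
        then show ?thesis using False by simp
      qed
      finally show ?thesis .
    qed
    then show ?thesis by (simp add: D_def)
  qed simp
qed

text \<open>If \<open>r\<close> is the integer root of \<open>n\<close>, at most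
  \<open>2 * r\<close> terms lie between \<open>r\<^sup>2\<close> and \<open>n\<close>. They
  contribute at most \<open>2 * r * B\<close>, which after division by \<open>r\<^sup>2\<close>
  leaves the vanishing error \<open>2 * B / r\<close>.\<close>

lemma average_tendsto_0_if_squares:
  fixes \<psi> :: "nat \<Rightarrow> real"
  assumes B: "\<And>i. \<bar>\<psi> i\<bar> \<le> B"
    and sq: "(\<lambda>n. (\<Sum>i<n\<^sup>2. \<psi> i) / real (n\<^sup>2)) \<longlonglongrightarrow> 0"
  shows "(\<lambda>n. (\<Sum>i<n. \<psi> i) / real n) \<longlonglongrightarrow> 0"
proof -
  have B0: "0 \<le> B" using B[of 0] by linarith
  have lim: "filterlim floor_sqrt at_top sequentially"
    unfolding filterlim_at_top
  proof
    fix Z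
    show "eventually (\<lambda>n. Z \<le> floor_sqrt n) sequentially"
      using eventually_ge_at_top[of "Z\<^sup>2"]
      by eventually_elim (metis floor_sqrt_inverse_power2 mono_floor_sqrt')
  qed
  define e where "e r = \<bar>(\<Sum>i<r\<^sup>2. \<psi> i) / real (r\<^sup>2)\<bar> + 2 * B / real r" for r
  have "e \<longlonglongrightarrow> 0"
    unfolding e_def
    by (rule tendsto_eq_intros tendsto_rabs sq lim_const_over_n | simp)+
  then have "(\<lambda>n. e (floor_sqrt n)) \<longlonglongrightarrow> 0"
    using lim by (rule filterlim_compose)
  then show ?thesis
  proof (rule Lim_null_comparison[rotated])
    show "\<forall>\<^sub>F n in sequentially. norm ((\<Sum>i<n. \<psi> i) / real n) \<le> e (floor_sqrt n)"
      using eventually_gt_at_top[of 0]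
    proof eventually_elim
      fix n :: nat assume n: "0 < n"
      define r where "r = floor_sqrt n"
      have r: "r\<^sup>2 \<le> n" "0 < r" "n < (Suc r)\<^sup>2"
        using n by (auto simp: r_def Suc_floor_sqrt_power2_gt)
      have le: "n - r\<^sup>2 \<le> 2 * r" using r by (simp add: power2_eq_square)
      have "(\<Sum>i<n. \<psi> i) = (\<Sum>i<r\<^sup>2. \<psi> i) + (\<Sum>i\<in>{r\<^sup>2..<n}. \<psi> i)"
        using sum.atLeastLessThan_concat[of 0 "r\<^sup>2" n \<psi>] r by (simp add: atLeast0LessThan)
      moreover have "\<bar>\<Sum>i\<in>{r\<^sup>2..<n}. \<psi> i\<bar> \<le> real (n - r\<^sup>2) * B"
      proof -
        have "(\<Sum>i\<in>{r\<^sup>2..<n}. \<bar>\<psi> i\<bar>) \<le> real (n - r\<^sup>2) * B"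
          using sum_bounded_above[of "{r\<^sup>2..<n}" "\<lambda>i. \<bar>\<psi> i\<bar>" B] B by simp
        then show ?thesis by (rule order_trans[OF sum_abs])
      qed
      moreover have "real (n - r\<^sup>2) * B \<le> (2 * real r) * B"
        using of_nat_mono[OF le, where 'a = real] B0 by (intro mult_right_mono) simp_all
      ultimately have "\<bar>\<Sum>i<n. \<psi> i\<bar> \<le> \<bar>\<Sum>i<r\<^sup>2. \<psi> i\<bar> + 2 * r * B" by linarith
      then have "\<bar>\<Sum>i<n. \<psi> i\<bar> / real n \<le> (\<bar>\<Sum>i<r\<^sup>2. \<psi> i\<bar> + 2 * r * B) / real (r\<^sup>2)"
        using r B0 of_nat_mono[OF r(1), where 'a=real] by (intro frac_le) auto
      also have "\<dots> = e r"
        using r by (simp add: e_def add_divide_distrib power2_eq_square)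
      finally show "norm ((\<Sum>i<n. \<psi> i) / real n) \<le> e (floor_sqrt n)"
        by (simp add: r_def)
    qed
  qed
qed

text \<open>Only pairs of indices less than \<open>m\<close> apart contribute to the second moment
  of the sum, which therefore grows at most linearly. Along \<open>n\<^sup>2\<close> the averages
  have second moments of order \<open>1 / n\<^sup>2\<close>; these are summable, so the averages
  tend to 0 almost surely along the squares, and boundedness fills the gaps.\<close>

lemma (in prob_space) average_tendsto_0_finite_range:
  fixes \<psi> :: "nat \<Rightarrow> 'a \<Rightarrow> real"
  assumes [measurable]: "\<And>i. \<psi> i \<in> borel_measurable M"
    and B: "\<And>i \<omega>. \<bar>\<psi> i \<omega>\<bar> \<le> B"
    and orth: "\<And>i j. i + m \<le> j \<Longrightarrow> expectation (\<lambda>\<omega>. \<psi> i \<omega> * \<psi> j \<omega>) = 0"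
  shows "AE \<omega> in M. (\<lambda>n. (\<Sum>i<n. \<psi> i \<omega>) / real n) \<longlonglongrightarrow> 0"
proof -
  have B0: "0 \<le> B" using B[of 0 undefined] by linarith
  have bd: "\<bar>\<psi> i \<omega> * \<psi> j \<omega>\<bar> \<le> B * B" for i j \<omega>
    unfolding abs_mult by (intro mult_mono B B0) simp
  have int: "integrable M (\<lambda>\<omega>. \<psi> i \<omega> * \<psi> j \<omega>)" for i j
    using bd by (intro integrable_const_bound[where B = "B * B"]) auto
  have le: "expectation (\<lambda>\<omega>. \<psi> i \<omega> * \<psi> j \<omega>) \<le> B * B" for i j
    using bd by (intro integral_le_const[OF int]) (auto simp: abs_le_iff)
  define v where "v n = expectation (\<lambda>\<omega>. (\<Sum>i<n. \<psi> i \<omega>)\<^sup>2)" for n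
  have v: "v n \<le> real n * (2 * real m * (B * B))" for n
  proof -
    have "v n = (\<Sum>i<n. \<Sum>j<n. expectation (\<lambda>\<omega>. \<psi> i \<omega> * \<psi> j \<omega>))"
      unfolding v_def power2_eq_square sum_product by (simp add: int)
    also have "\<dots> \<le> (\<Sum>i<n. 2 * real m * (B * B))"
    proof (rule sum_mono)
      fix i
      \<comment> \<open>Outside this range of at most \<open>2 * m\<close> indices, orthogonality
        applies to \<open>i\<close>, \<open>j\<close> in one of the two orders.\<close>
      have "expectation (\<lambda>\<omega>. \<psi> i \<omega> * \<psi> j \<omega>) \<le> (if j \<in> {i-m..<i+m} then B * B else 0)" for j
        using le[of i j] orth[of i j] orth[of j i] by (auto simp: mult.commute)
      then have "(\<Sum>j<n. expectation (\<lambda>\<omega>. \<psi> i \<omega> * \<psi> j \<omega>))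
          \<le> (\<Sum>j<n. if j \<in> {i-m..<i+m} then B * B else 0)"
        by (intro sum_mono)
      also have "\<dots> = (\<Sum>j\<in>{..<n} \<inter> {i-m..<i+m}. B * B)"
        by (rule sum.inter_restrict[symmetric]) simp
      also have "\<dots> \<le> (\<Sum>j\<in>{i-m..<i+m}. B * B)"
        using B0 by (intro sum_mono2) auto
      also have "\<dots> \<le> (2 * real m) * (B * B)"
        using B0 by (auto intro!: mult_right_mono)
      finally show "(\<Sum>j<n. expectation (\<lambda>\<omega>. \<psi> i \<omega> * \<psi> j \<omega>)) \<le> 2 * real m * (B * B)" .
    qed
    finally show ?thesis by simp
  qed
  define a where "a n \<omega> = (\<Sum>i<n\<^sup>2. \<psi> i \<omega>) / real (n\<^sup>2)" for n \<omega>
  have [measurable]: "a n \<in> borel_measurable M" for n unfolding a_def by simp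
  define K where "K = 2 * real m * (B * B)"
  have K0: "0 \<le> K" by (simp add: K_def B0)
  have "(\<integral>\<^sup>+\<omega>. (\<Sum>n. ennreal ((a n \<omega>)\<^sup>2)) \<partial>M) = (\<Sum>n. \<integral>\<^sup>+\<omega>. ennreal ((a n \<omega>)\<^sup>2) \<partial>M)"
    by (rule nn_integral_suminf) simp
  \<comment> \<open>At \<open>n = 0\<close> both sides are 0, since division by zero gives
    0.\<close>
  also have "\<dots> \<le> (\<Sum>n. ennreal (K / real n ^ 2))"
  proof (intro suminf_le summableI)
    fix n
    have int2: "integrable M (\<lambda>\<omega>. (\<Sum>i<n. \<psi> i \<omega>)\<^sup>2)" for n
      unfolding power2_eq_square sum_product by (simp add: int)
    have "(\<integral>\<^sup>+\<omega>. ennreal ((a n \<omega>)\<^sup>2) \<partial>M) = ennreal (expectation (\<lambda>\<omega>. (a n \<omega>)\<^sup>2))"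
      unfolding a_def power_divide using int2 by (intro nn_integral_eq_integral) auto
    also have "expectation (\<lambda>\<omega>. (a n \<omega>)\<^sup>2) = v (n\<^sup>2) / (real (n\<^sup>2))\<^sup>2"
      by (simp add: a_def power_divide v_def)
    also have "\<dots> \<le> real (n\<^sup>2) * K / (real (n\<^sup>2))\<^sup>2"
      using v[of "n\<^sup>2"] by (intro divide_right_mono) (auto simp: K_def)
    also have "\<dots> = K / real n ^ 2"
      by (simp add: power2_eq_square)
    finally show "(\<integral>\<^sup>+\<omega>. ennreal ((a n \<omega>)\<^sup>2) \<partial>M) \<le> ennreal (K / real n ^ 2)"
      by (simp add: ennreal_leI)
  qed
  also have "\<dots> < \<infinity>"
  proof -
    have "summable (\<lambda>n. K * (1 / real n ^ 2))"
      using inverse_power_summable[of 2, where 'a = real]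
      by (intro summable_mult) (simp add: divide_inverse)
    then have "(\<Sum>n. ennreal (K * (1 / real n ^ 2))) \<noteq> top"
      using K0 by (intro ennreal_suminf_neq_top) auto
    then show ?thesis by (simp add: less_top)
  qed
  finally have "(\<integral>\<^sup>+\<omega>. (\<Sum>n. ennreal ((a n \<omega>)\<^sup>2)) \<partial>M) \<noteq> \<infinity>" by simp
  then have "AE \<omega> in M. (\<Sum>n. ennreal ((a n \<omega>)\<^sup>2)) \<noteq> \<infinity>"
    by (rule nn_integral_noteq_infinite[rotated]) simp
  then show ?thesis
  proof eventually_elim
    fix \<omega> assume "(\<Sum>n. ennreal ((a n \<omega>)\<^sup>2)) \<noteq> \<infinity>"
    then have "summable (\<lambda>n. (a n \<omega>)\<^sup>2)"
      by (intro summable_suminf_not_top) auto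
    then have "(\<lambda>n. (a n \<omega>)\<^sup>2) \<longlonglongrightarrow> 0" by (rule summable_LIMSEQ_zero)
    then have "(\<lambda>n. sqrt ((a n \<omega>)\<^sup>2)) \<longlonglongrightarrow> sqrt 0" by (rule tendsto_real_sqrt)
    then have "(\<lambda>n. a n \<omega>) \<longlonglongrightarrow> 0" by (simp add: tendsto_rabs_zero_iff)
    then show "(\<lambda>n. (\<Sum>i<n. \<psi> i \<omega>) / real n) \<longlonglongrightarrow> 0"
      unfolding a_def using B by (intro average_tendsto_0_if_squares[of _ B]) auto
  qed
qed

subsection \<open>Random walks with independent identically distributed steps\<close>

lemma returns_split:
  assumes "i \<le> n" "psum y i = 0"
  shows "returns y n = returns y i + returns (seq_shift i y) (n - i)"
proof -
  have "{k\<in>{1..n}. psum y k = 0} = {k\<in>{1..i}. psum y k = 0} \<union> {k\<in>{i<..n}. psum y k = 0}"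
    using assms(1) by auto
  then have "returns y n = returns y i + card {k\<in>{i<..n}. psum y k = 0}"
    unfolding returns_def by (simp add: card_Un_disjoint disjoint_iff)
  then show ?thesis using returns_shift[OF assms(1), of y] assms(2) by simp
qed

text \<open>The count increases by at most one at a time, so at the first time it reaches
  \<open>k\<close> it equals \<open>k\<close>, and the path is at 0 then. For \<open>k = 0\<close>
  this is time 0, where the empty sum vanishes.\<close>

lemma kth_return_time:
  assumes "k \<le> returns y n"
  obtains t where "t \<le> n" "psum y t = 0" "returns y t = k"
proof -
  define t where "t = (LEAST t. k \<le> returns y t)"
  have t: "k \<le> returns y t" "t \<le> n"
    unfolding t_def using assms by (auto intro: LeastI Least_le)
  show thesis
  proof (cases t)
    case 0
    then show ?thesis using t that[of t] by (simp add: psum_def)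
  next
    case (Suc s)
    have "\<not> k \<le> returns y s"
      using not_less_Least[of s "\<lambda>t. k \<le> returns y t"] Suc by (simp add: t_def)
    then show ?thesis
      using t that[of t] Suc by (auto simp: returns_Suc of_bool_def split: if_splits)
  qed
qed

text \<open>On countable types the product of the discrete sigma-algebras is again discrete, so any
  binary operation is measurable.\<close>

lemma measurable_countable_compose2:
  fixes f :: "'a \<Rightarrow> 'b::countable" and g :: "'a \<Rightarrow> 'c::countable"
  assumes "f \<in> M \<rightarrow>\<^sub>M count_space UNIV" "g \<in> M \<rightarrow>\<^sub>M count_space UNIV"
  shows "(\<lambda>x. h (f x) (g x)) \<in> M \<rightarrow>\<^sub>M count_space UNIV"
proof -
  have "(\<lambda>x. (f x, g x)) \<in> M \<rightarrow>\<^sub>M count_space UNIV \<Otimes>\<^sub>M count_space UNIV"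
    using assms by simp
  then have "(\<lambda>x. (f x, g x)) \<in> M \<rightarrow>\<^sub>M count_space UNIV"
    by (simp add: pair_measure_countable)
  then have "(\<lambda>x. case_prod h (f x, g x)) \<in> M \<rightarrow>\<^sub>M count_space UNIV"
    by (rule measurable_compose) simp
  then show ?thesis by simp
qed

text \<open>The canonical model: \<open>M\<close> is the law of one step, and the steps are the
  coordinates on the infinite product \<open>S\<close>. Here the time shift is a map of the
  probability space into itself.\<close>

locale group_walk = sequence_space M for M :: "'b::{ab_group_add, countable} measure" +
  assumes sets_M: "sets M = UNIV"
begin

section \<open>Measurability, stationarity and independence of past and future\<close>

lemma space_M: "space M = UNIV"
  by (metis UNIV_I sets_M sets.sets_into_space top.extremum_uniqueI)

lemma space_S [simp]: "space S = UNIV"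
  by (simp add: space_PiM space_M)

lemma measurable_psum [measurable]: "(\<lambda>y. psum y n) \<in> S \<rightarrow>\<^sub>M count_space UNIV"
proof (induction n)
  case (Suc n)
  have "(\<lambda>y. y n) \<in> S \<rightarrow>\<^sub>M M" by measurable
  then have "(\<lambda>y. y n) \<in> S \<rightarrow>\<^sub>M count_space UNIV"
    using measurable_cong_sets[OF refl, of M "count_space UNIV" S] by (simp add: sets_M)
  from measurable_countable_compose2[OF Suc this, of "(+)"]
  show ?case by (simp add: psum_def)
qed (simp add: psum_def)

lemma measurable_returns [measurable]: "(\<lambda>y. returns y n) \<in> S \<rightarrow>\<^sub>M count_space UNIV"
proof (induction n)
  case (Suc n)
  from measurable_countable_compose2[OF Suc measurable_psum, of "\<lambda>a b. a + of_bool (b = 0)"]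
  show ?case by (simp add: returns_Suc)
qed simp

lemma measurable_shift [measurable]: "seq_shift i \<in> S \<rightarrow>\<^sub>M S"
  unfolding seq_shift_def by (rule measurable_abs_UNIV) simp

lemma shift_comb_seq: "seq_shift t (comb_seq t \<omega> \<omega>') = \<omega>'"
  by (simp add: seq_shift_def comb_seq_def)

text \<open>Putting the first \<open>i\<close> entries of one sequence in front of an independent
  one again gives the law \<open>S\<close>. The shift removes those entries and returns the second
  sequence, which has law \<open>S\<close>.\<close>

lemma distr_shift: "distr S S (seq_shift i) = S"
proof -
  interpret SS: pair_prob_space S S ..
  have "distr S S (seq_shift i) = distr (distr (S \<Otimes>\<^sub>M S) S (\<lambda>(\<omega>, \<omega>'). comb_seq i \<omega> \<omega>')) S (seq_shift i)"
    by (simp add: PiM_comb_seq)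
  also have "\<dots> = distr (S \<Otimes>\<^sub>M S) S snd"
    by (subst distr_distr) (auto simp: comp_def shift_comb_seq measurable_comb_seq intro!: distr_cong)
  also have "\<dots> = S"
  proof (rule measure_eqI)
    fix A assume A: "A \<in> sets (distr (S \<Otimes>\<^sub>M S) S snd)"
    then have "emeasure (distr (S \<Otimes>\<^sub>M S) S snd) A = emeasure (S \<Otimes>\<^sub>M S) (UNIV \<times> A)"
      by (subst emeasure_distr) (auto simp: space_pair_measure intro!: arg_cong2[where f = emeasure])
    also have "\<dots> = emeasure S A"
      using A sets.top[of S] P.emeasure_space_1 by (subst P.emeasure_pair_measure_Times) auto
    finally show "emeasure (distr (S \<Otimes>\<^sub>M S) S snd) A = emeasure S A" .
  qed simp
  finally show ?thesis .
qed

lemma nn_integral_shift: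
  assumes "f \<in> borel_measurable S"
  shows "(\<integral>\<^sup>+y. f (seq_shift i y) \<partial>S) = (\<integral>\<^sup>+y. f y \<partial>S)"
proof -
  have "(\<integral>\<^sup>+y. f y \<partial>S) = (\<integral>\<^sup>+y. f y \<partial>distr S S (seq_shift i))" by (simp add: distr_shift)
  then show ?thesis using assms by (simp add: nn_integral_distr)
qed

lemma integral_shift:
  fixes f :: "_ \<Rightarrow> real"
  assumes "f \<in> borel_measurable S"
  shows "(\<integral>y. f (seq_shift i y) \<partial>S) = (\<integral>y. f y \<partial>S)"
proof -
  have "(\<integral>y. f y \<partial>S) = (\<integral>y. f y \<partial>distr S S (seq_shift i))" by (simp add: distr_shift)
  then show ?thesis using assms by (simp add: integral_distr)
qed

lemma emeasure_shift:
  assumes "A \<in> sets S"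
  shows "emeasure S (seq_shift i -` A) = emeasure S A"
proof -
  have "emeasure S A = emeasure (distr S S (seq_shift i)) A" by (simp add: distr_shift)
  then show ?thesis using assms by (simp add: emeasure_distr)
qed

text \<open>Under the gluing representation of \<open>S\<close>, \<open>past\<close> makes the first
  factor a function of the first sequence alone, while the shifted factor sees only the second.
  Fubini then factors the integral, boundedness giving integrability.\<close>

lemma integral_past_future:
  fixes f g :: "_ \<Rightarrow> real"
  assumes [measurable]: "f \<in> borel_measurable S" "g \<in> borel_measurable S"
    and bd: "\<And>y. \<bar>f y\<bar> \<le> B" "\<And>y. \<bar>g y\<bar> \<le> C"
    and past: "\<And>\<omega> \<omega>'. f (comb_seq t \<omega> \<omega>') = f \<omega>"
  shows "(\<integral>y. f y * g (seq_shift t y) \<partial>S) = (\<integral>y. f y \<partial>S) * (\<integral>y. g y \<partial>S)"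
proof -
  interpret SS: pair_prob_space S S ..
  have "(\<integral>y. f y * g (seq_shift t y) \<partial>S)
    = (\<integral>y. f y * g (seq_shift t y) \<partial>distr (S \<Otimes>\<^sub>M S) S (\<lambda>(\<omega>, \<omega>'). comb_seq t \<omega> \<omega>'))"
    by (simp add: PiM_comb_seq)
  also have "\<dots> = (\<integral>z. f (fst z) * g (snd z) \<partial>(S \<Otimes>\<^sub>M S))"
    by (subst integral_distr)
      (auto simp: measurable_comb_seq shift_comb_seq past split_beta' intro!: Bochner_Integration.integral_cong)
  also have "\<dots> = (\<integral>\<omega>. (\<integral>\<omega>'. f \<omega> * g \<omega>' \<partial>S) \<partial>S)"
  proof (subst SS.integral_fst'[symmetric])
    have "\<bar>f (fst z) * g (snd z)\<bar> \<le> B * C" for z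
      unfolding abs_mult using bd order_trans[OF abs_ge_zero bd(1)] by (intro mult_mono) auto
    then show "integrable (S \<Otimes>\<^sub>M S) (\<lambda>z. f (fst z) * g (snd z))"
      by (intro SS.P.integrable_const_bound[where B = "B * C"]) auto
  qed simp
  also have "\<dots> = (\<integral>y. f y \<partial>S) * (\<integral>y. g y \<partial>S)"
    by simp
  finally show ?thesis .
qed

lemma measure_past_future:
  assumes [measurable]: "A \<in> sets S" "B \<in> sets S"
    and past: "\<And>\<omega> \<omega>'. comb_seq t \<omega> \<omega>' \<in> A \<longleftrightarrow> \<omega> \<in> A"
  shows "measure S (A \<inter> seq_shift t -` B) = measure S A * measure S B"
proof -
  have "measure S (A \<inter> seq_shift t -` B) = (\<integral>y. indicator (A \<inter> seq_shift t -` B) y \<partial>S)"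
    by simp
  also have "\<dots> = (\<integral>y. indicator A y * indicator B (seq_shift t y) \<partial>S)"
    by (intro Bochner_Integration.integral_cong) (auto split: split_indicator)
  also have "\<dots> = measure S A * measure S B"
    by (subst integral_past_future[where B = 1 and C = 1])
      (auto simp: past split: split_indicator)
  finally show ?thesis .
qed

section \<open>The geometric law of the number of returns\<close>

definition return_prob :: real where
  "return_prob = measure S {y. \<exists>n\<ge>1. psum y n = 0}"

lemma return_prob_bounds: "0 \<le> return_prob" "return_prob \<le> 1"
  by (simp_all add: return_prob_def P.prob_le_1)

text \<open>Regeneration at the \<open>k\<close>-th return: the event is split by the deterministic
  value \<open>t\<close> of that return time. \<open>B t\<close> depends only on the first
  \<open>t\<close> steps, and one more return means that the path shifted by \<open>t\<close>
  returns, which is independent of \<open>B t\<close> with probability \<open>return_prob\<close>.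
  Summing over \<open>t\<close> yields the induction step.\<close>

lemma prob_returns_ge: "measure S {y. \<exists>n. k \<le> returns y n} = return_prob ^ k"
proof (induction k)
  case 0
  then show ?case using P.prob_space by simp
next
  case (Suc k)
  define A where "A k = {y :: nat \<Rightarrow> 'b. \<exists>n. k \<le> returns y n}" for k :: nat
  define B where "B t = {y :: nat \<Rightarrow> 'b. psum y t = 0 \<and> returns y t = k}" for t
  have [measurable]: "A k \<in> sets S" for k
  proof -
    have "{y\<in>space S. \<exists>n. k \<le> returns y n} \<in> sets S" by measurable
    then show ?thesis by (simp add: A_def)
  qed
  have [measurable]: "B t \<in> sets S" for t
  proof -
    have "{y\<in>space S. psum y t = 0 \<and> returns y t = k} \<in> sets S" by measurable
    then show ?thesis by (simp add: B_def)
  qed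
  have A1: "measure S (A 1) = return_prob"
  proof -
    have "1 \<le> returns y n \<longleftrightarrow> (\<exists>k\<in>{1..n}. psum y k = 0)" for y :: "nat \<Rightarrow> 'b" and n
      by (auto simp: returns_def Suc_le_eq card_gt_0_iff)
    then have "A 1 = {y. \<exists>n\<ge>1. psum y n = 0}" by (fastforce simp: A_def)
    then show ?thesis by (simp add: return_prob_def)
  qed
  have disj: "B s \<inter> B t = {}" if "s < t" for s t
  proof -
    \<comment> \<open>A visit to 0 at time \<open>t\<close> is itself counted, so the count cannot
      already have been the same at an earlier time \<open>s\<close>.\<close>
    have "returns y s < returns y t" if "psum y t = 0" for y :: "nat \<Rightarrow> 'b"
    proof -
      obtain r where t: "t = Suc r" "s \<le> r" using \<open>s < t\<close> by (cases t) auto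
      then have "returns y s \<le> returns y r" using mono_returns by (auto simp: mono_def)
      then show ?thesis using that t by (simp add: returns_Suc)
    qed
    then show ?thesis by (force simp: B_def)
  qed
  then have disjB: "disjoint_family B"
    unfolding disjoint_family_on_def by (metis inf_commute linorder_neqE_nat)
  have UB: "(\<Union>t. B t) = A k"
    by (auto simp: A_def B_def elim: kth_return_time)
  have UBA: "(\<Union>t. B t \<inter> seq_shift t -` A 1) = A (Suc k)"
  proof (intro equalityI subsetI)
    fix y assume "y \<in> (\<Union>t. B t \<inter> seq_shift t -` A 1)"
    then obtain t n where "psum y t = 0" "returns y t = k" "1 \<le> returns (seq_shift t y) n"
      by (auto simp: A_def B_def)
    then have "Suc k \<le> returns y (t + n)" using returns_split[of t "t + n" y] by simp
    then show "y \<in> A (Suc k)" by (auto simp: A_def)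
  next
    fix y assume "y \<in> A (Suc k)"
    then obtain n where n: "Suc k \<le> returns y n" by (auto simp: A_def)
    then have "k \<le> returns y n" by simp
    then obtain t where t: "t \<le> n" "psum y t = 0" "returns y t = k" by (rule kth_return_time)
    then have "1 \<le> returns (seq_shift t y) (n - t)" using returns_split[of t n y] n by simp
    then show "y \<in> (\<Union>t. B t \<inter> seq_shift t -` A 1)" using t by (auto simp: A_def B_def)
  qed
  have past: "comb_seq t \<omega> \<omega>' \<in> B t \<longleftrightarrow> \<omega> \<in> B t" for t \<omega> \<omega>'
    using psum_cong[of t "comb_seq t \<omega> \<omega>'" \<omega>] returns_cong[of t "comb_seq t \<omega> \<omega>'" \<omega>]
    by (simp add: B_def comb_seq_def)
  have "(\<lambda>t. measure S (B t) * return_prob) sums (measure S (A k) * return_prob)"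
  proof (rule sums_mult2)
    have "range B \<subseteq> sets S" by auto
    from P.finite_measure_UNION[OF this disjB] show "(\<lambda>t. measure S (B t)) sums measure S (A k)"
      by (simp add: UB)
  qed
  moreover have "(\<lambda>t. measure S (B t \<inter> seq_shift t -` A 1)) sums measure S (A (Suc k))"
  proof -
    have "disjoint_family (\<lambda>t. B t \<inter> seq_shift t -` A 1)"
      using disjB unfolding disjoint_family_on_def by blast
    moreover have "B t \<inter> seq_shift t -` A 1 \<in> sets S" for t
    proof -
      have "seq_shift t -` A 1 \<inter> space S \<in> sets S" by (intro measurable_sets[of _ S S]) measurable
      then show ?thesis by auto
    qed
    ultimately show ?thesis
      using P.finite_measure_UNION[of "\<lambda>t. B t \<inter> seq_shift t -` A 1"]
      unfolding UBA image_subset_iff by blast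
  qed
  ultimately have "measure S (A (Suc k)) = measure S (A k) * return_prob"
    using A1 by (simp add: measure_past_future past sums_iff)
  then show ?case using Suc by (simp add: A_def)
qed

section \<open>Integrals along the returns, and the maximal ergodic inequality\<close>

lemma sets_returns_ge [measurable]: "{y. \<exists>n. k \<le> returns y n} \<in> sets S"
proof -
  have "{y\<in>space S. \<exists>n. k \<le> returns y n} \<in> sets S" by measurable
  then show ?thesis by simp
qed

text \<open>Whatever value the count takes at time \<open>n\<close>, the path has reached that
  level, so \<open>g (returns y n)\<close> is one of the terms of the series of \<open>g k\<close>
  over all levels \<open>k\<close> reached. The series does not depend on \<open>n\<close> and also
  bounds the supremum; level \<open>k\<close> is reached with probability
  \<open>return_prob ^ k\<close>.\<close>

lemma nn_integral_SUP_returns: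
  fixes g :: "nat \<Rightarrow> ennreal"
  shows "(\<integral>\<^sup>+y. (SUP n. g (returns y n)) \<partial>S) \<le> (\<Sum>k. g k * ennreal (return_prob ^ k))"
proof -
  define A where "A k = {y :: nat \<Rightarrow> 'b. \<exists>n. k \<le> returns y n}" for k :: nat
  have [measurable]: "A k \<in> sets S" for k unfolding A_def by measurable
  have "(\<integral>\<^sup>+y. (SUP n. g (returns y n)) \<partial>S) \<le> (\<integral>\<^sup>+y. (\<Sum>k. g k * indicator (A k) y) \<partial>S)"
  proof (intro nn_integral_mono SUP_least)
    fix y :: "nat \<Rightarrow> 'b" and n
    have "g (returns y n) = (\<Sum>k\<in>{returns y n}. g k * indicator (A k) y)"
    proof -
      have "y \<in> A (returns y n)" by (auto simp: A_def)
      then show ?thesis by simp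
    qed
    also have "\<dots> \<le> (\<Sum>k. g k * indicator (A k) y)"
      by (intro sum_le_suminf summableI) auto
    finally show "g (returns y n) \<le> (\<Sum>k. g k * indicator (A k) y)" .
  qed
  also have "\<dots> = (\<Sum>k. g k * emeasure S (A k))"
    by (subst nn_integral_suminf) (auto simp: nn_integral_cmult_indicator)
  also have "\<dots> = (\<Sum>k. g k * ennreal (return_prob ^ k))"
    by (simp add: P.emeasure_eq_measure A_def prob_returns_ge)
  finally show ?thesis .
qed

lemma nn_integral_returns_le:
  fixes g :: "nat \<Rightarrow> ennreal"
  shows "(\<integral>\<^sup>+y. g (returns y n) \<partial>S) \<le> (\<Sum>k. g k * ennreal (return_prob ^ k))"
  by (rule order_trans[OF nn_integral_mono nn_integral_SUP_returns]) (auto intro: SUP_upper)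

text \<open>Reaching every level has probability at most \<open>return_prob ^ k\<close> for each
  \<open>k\<close>, hence 0. Off this event the count is a bounded increasing sequence of
  integers.\<close>

lemma AE_returns_eventually_constant:
  assumes "return_prob < 1"
  shows "AE y in S. \<exists>k. \<forall>\<^sub>F n in sequentially. returns y n = k"
proof -
  define A where "A k = {y :: nat \<Rightarrow> 'b. \<exists>n. k \<le> returns y n}" for k :: nat
  have [measurable]: "A k \<in> sets S" for k unfolding A_def by measurable
  have "measure S (\<Inter>k. A k) \<le> return_prob ^ k" for k
    unfolding prob_returns_ge[symmetric] A_def[symmetric]
    by (intro P.finite_measure_mono) auto
  moreover have "(\<lambda>k. return_prob ^ k) \<longlonglongrightarrow> 0"
    using return_prob_bounds assms by (intro LIMSEQ_realpow_zero)
  ultimately have "measure S (\<Inter>k. A k) \<le> 0"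
    by (meson LIMSEQ_le_const)
  then have "emeasure S (\<Inter>k. A k) = 0"
    by (simp add: P.emeasure_eq_measure measure_le_0_iff)
  then have "AE y in S. y \<notin> (\<Inter>k. A k)"
    by (intro AE_not_in) (auto simp: null_sets_def)
  then show ?thesis
  proof eventually_elim
    case (elim y)
    then obtain K where K: "\<And>n. returns y n < K" by (auto simp: A_def not_le)
    define k where "k = Max (range (returns y))"
    have fin: "finite (range (returns y))" using K by (auto intro: finite_subset[of _ "{..<K}"])
    then have "k \<in> range (returns y)" unfolding k_def by (intro Max_in) auto
    then obtain n0 where "k = returns y n0" by auto
    then have "returns y n = k" if "n \<ge> n0" for n
      using that monoD[OF mono_returns, of n0 n y] Max_ge[OF fin, of "returns y n"]
      by (simp add: k_def)
    then show ?case by (auto simp: eventually_sequentially)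
  qed
qed

text \<open>The probability of exactly \<open>k\<close> returns up to time \<open>m\<close> is a
  difference of two tail probabilities and converges to the geometric weight. It is at most
  \<open>return_prob ^ k\<close> uniformly in \<open>m\<close>, so Tannery's theorem passes to the
  limit in the series.\<close>

lemma integral_returns_tendsto:
  assumes "summable (\<lambda>k. \<bar>h k\<bar> * return_prob ^ k)"
  shows "(\<lambda>m. \<integral>y. h (returns y m) \<partial>S)
    \<longlonglongrightarrow> (\<Sum>k. h k * (return_prob ^ k - return_prob ^ Suc k))"
proof -
  define A where "A k m = {y :: nat \<Rightarrow> 'b. k \<le> returns y m}" for k m :: nat
  have [measurable]: "A k m \<in> sets S" for k m
  proof -
    have "{y\<in>space S. k \<le> returns y m} \<in> sets S" by measurable
    then show ?thesis by (simp add: A_def)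
  qed
  have lim: "(\<lambda>m. measure S (A k m)) \<longlonglongrightarrow> return_prob ^ k" for k
  proof -
    have "incseq (A k)"
      using mono_returns by (auto simp: A_def incseq_def mono_def intro: order_trans)
    then have "(\<lambda>m. measure S (A k m)) \<longlonglongrightarrow> measure S (\<Union>m. A k m)"
      by (intro P.finite_Lim_measure_incseq) auto
    also have "(\<Union>m. A k m) = {y. \<exists>n. k \<le> returns y n}" by (auto simp: A_def)
    finally show ?thesis by (simp add: prob_returns_ge)
  qed
  define p where "p k m = measure S (A k m) - measure S (A (Suc k) m)" for k m
  have p: "p k m = measure S {y. returns y m = k}" for k m
  proof -
    have "A k m - A (Suc k) m = {y. returns y m = k}" by (auto simp: A_def)
    moreover have "A (Suc k) m \<subseteq> A k m" by (auto simp: A_def)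
    ultimately show ?thesis using P.finite_measure_Diff[of "A k m" "A (Suc k) m"] by (simp add: p_def)
  qed
  have p_le: "p k m \<le> return_prob ^ k" for k m
    unfolding p prob_returns_ge[symmetric] by (intro P.finite_measure_mono) auto
  have "(\<lambda>m. \<Sum>k. h k * p k m) \<longlonglongrightarrow> (\<Sum>k. h k * (return_prob ^ k - return_prob ^ Suc k))"
  proof (rule tannerys_theorem[THEN conjunct2, THEN conjunct2])
    show "(\<lambda>m. h k * p k m) \<longlonglongrightarrow> h k * (return_prob ^ k - return_prob ^ Suc k)" for k
      unfolding p_def by (intro tendsto_intros lim)
    show "\<forall>\<^sub>F (k, m) in sequentially \<times>\<^sub>F sequentially. norm (h k * p k m) \<le> \<bar>h k\<bar> * return_prob ^ k"
      using p_le by (intro always_eventually) (auto simp: abs_mult p intro!: mult_left_mono)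
  qed (use assms in auto)
  moreover have "(\<integral>y. h (returns y m) \<partial>S) = (\<Sum>k. h k * p k m)" for m
  proof -
    have sets: "{y. returns y m = k} \<in> sets S" for k
    proof -
      have "{y\<in>space S. returns y m = k} \<in> sets S" by measurable
      then show ?thesis by simp
    qed
    have "h (returns y m) = (\<Sum>k\<le>m. h k * indicator {y. returns y m = k} y)" for y :: "nat \<Rightarrow> 'b"
      using returns_le[of y m] by (simp add: indicator_def of_bool_def if_distrib cong: if_cong)
    then have "(\<integral>y. h (returns y m) \<partial>S) = (\<integral>y. (\<Sum>k\<le>m. h k * indicator {y. returns y m = k} y) \<partial>S)"
      by simp
    also have "\<dots> = (\<Sum>k\<le>m. h k * p k m)"
      using sets by (subst Bochner_Integration.integral_sum)
        (auto simp: p P.emeasure_eq_measure intro!: integrable_mult_right integrable_real_indicator)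
    also have "\<dots> = (\<Sum>k. h k * p k m)"
    proof (rule suminf_finite[symmetric])
      fix k assume "k \<notin> {..m}"
      then have "{y::nat \<Rightarrow> 'b. returns y m = k} = {}" using returns_le[of _ m] by (force simp: not_le)
      then show "h k * p k m = 0" by (simp add: p)
    qed simp
    finally show ?thesis .
  qed
  ultimately show ?thesis by simp
qed

text \<open>Almost surely the count is eventually constant, so the oscillation after
  \<open>m\<close> vanishes for large \<open>m\<close>. Twice the supremum of the absolute values of
  \<open>h\<close> along the path is an integrable dominating function.\<close>

lemma nn_integral_oscillation_tendsto_0:
  assumes "summable (\<lambda>k. \<bar>h k\<bar> * return_prob ^ k)" "return_prob < 1"
  shows "(\<lambda>m. \<integral>\<^sup>+y. (SUP n. ennreal \<bar>h (returns y (m + n)) - h (returns y m)\<bar>) \<partial>S) \<longlonglongrightarrow> 0"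
proof -
  define Z where "Z m y = (SUP n. ennreal \<bar>h (returns y (m + n)) - h (returns y m)\<bar>)"
    for m and y :: "nat \<Rightarrow> 'b"
  define W where "W y = (SUP n. ennreal \<bar>h (returns y n)\<bar>)" for y :: "nat \<Rightarrow> 'b"
  have "(\<lambda>m. \<integral>\<^sup>+y. Z m y \<partial>S) \<longlonglongrightarrow> (\<integral>\<^sup>+y. 0 \<partial>S)"
  proof (rule nn_integral_dominated_convergence[where w = "\<lambda>y. 2 * W y"])
    show "Z m \<in> borel_measurable S" for m unfolding Z_def by measurable
    show "(\<lambda>y. 2 * W y) \<in> borel_measurable S" unfolding W_def by measurable
    show "AE y in S. Z m y \<le> 2 * W y" for m
    proof (rule AE_I2)
      fix y :: "nat \<Rightarrow> 'b"
      have "ennreal \<bar>h (returns y (m + n)) - h (returns y m)\<bar>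
          \<le> ennreal \<bar>h (returns y (m + n))\<bar> + ennreal \<bar>h (returns y m)\<bar>" for n
        by (simp add: ennreal_leI abs_triangle_ineq4 flip: ennreal_plus)
      also have "\<dots> n \<le> W y + W y" for n
        unfolding W_def by (intro add_mono SUP_upper) auto
      finally show "Z m y \<le> 2 * W y"
        unfolding Z_def by (simp add: SUP_le_iff mult_2)
    qed
    have "(\<integral>\<^sup>+y. W y \<partial>S) \<le> (\<Sum>k. ennreal \<bar>h k\<bar> * ennreal (return_prob ^ k))"
      unfolding W_def by (rule nn_integral_SUP_returns)
    also have "\<dots> = (\<Sum>k. ennreal (\<bar>h k\<bar> * return_prob ^ k))"
      using return_prob_bounds by (simp add: ennreal_mult)
    also have "\<dots> < \<infinity>"
    proof -
      have "(\<Sum>k. ennreal (\<bar>h k\<bar> * return_prob ^ k)) \<noteq> top"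
        by (rule ennreal_suminf_neq_top[OF assms(1)]) (simp add: return_prob_bounds(1))
      then show ?thesis by (simp add: top.not_eq_extremum)
    qed
    finally have "(\<integral>\<^sup>+y. W y \<partial>S) < \<infinity>" .
    moreover have "W \<in> borel_measurable S" unfolding W_def by measurable
    ultimately show "(\<integral>\<^sup>+y. 2 * W y \<partial>S) < \<infinity>"
      by (simp add: nn_integral_cmult ennreal_mult_less_top)
    show "AE y in S. (\<lambda>m. Z m y) \<longlonglongrightarrow> 0"
      using AE_returns_eventually_constant[OF assms(2)]
    proof eventually_elim
      case (elim y)
      then obtain k n0 where k: "\<And>n. n \<ge> n0 \<Longrightarrow> returns y n = k"
        by (auto simp: eventually_sequentially)
      then have "Z m y = 0" if "m \<ge> n0" for m
        using that by (simp add: Z_def)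
      then show ?case
        by (intro tendsto_eventually) (auto simp: eventually_sequentially)
    qed
  qed simp_all
  then show ?thesis by (simp add: Z_def)
qed

text \<open>The covering inequality is averaged over \<open>N\<close> starting points. By
  stationarity each one starts a heavy window of length at most \<open>m\<close> with the same
  probability, while the covering sum has expectation \<open>N + m\<close> times the mean of
  \<open>Z\<close>. Dividing by \<open>N\<close> and letting \<open>N\<close>, then
  \<open>m\<close>, tend to infinity gives the claim. If the mean is infinite there is nothing to
  show.\<close>

lemma maximal_inequality:
  fixes Z :: "(nat \<Rightarrow> 'b) \<Rightarrow> ennreal" and L :: real
  assumes [measurable]: "Z \<in> borel_measurable S" and L: "0 < L"
  shows "ennreal L * emeasure S {y. \<exists>n. ennreal L * of_nat (Suc n) < (\<Sum>j<Suc n. Z (seq_shift j y))}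
    \<le> (\<integral>\<^sup>+y. Z y \<partial>S)"
proof (cases "(\<integral>\<^sup>+y. Z y \<partial>S) = \<infinity>")
  case False
  define D where "D m = {y. \<exists>n<m. ennreal L * of_nat (Suc n) < (\<Sum>j<Suc n. Z (seq_shift j y))}" for m
  have [measurable]: "D m \<in> sets S" for m
  proof -
    have "{y\<in>space S. \<exists>n<m. ennreal L * of_nat (Suc n) < (\<Sum>j<Suc n. Z (seq_shift j y))} \<in> sets S"
      by measurable
    then show ?thesis by (simp add: D_def)
  qed
  obtain e where e: "(\<integral>\<^sup>+y. Z y \<partial>S) = ennreal e" "0 \<le> e"
    using False by (cases "\<integral>\<^sup>+y. Z y \<partial>S") auto
  have D: "L * measure S (D m) \<le> e" for m
  proof -
    have "L * measure S (D m) \<le> e + real m * e / real N" if N: "0 < N" for N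
    proof -
      have "of_nat N * ennreal L * emeasure S (D m) = (\<Sum>i<N. ennreal L * emeasure S (seq_shift i -` D m))"
        by (simp add: emeasure_shift mult.assoc)
      also have "\<dots> = (\<Sum>i<N. \<integral>\<^sup>+y. ennreal L * indicator (D m) (seq_shift i y) \<partial>S)"
      proof (rule sum.cong[OF refl])
        fix i
        have "(\<integral>\<^sup>+y. ennreal L * indicator (D m) (seq_shift i y) \<partial>S)
            = (\<integral>\<^sup>+y. ennreal L * indicator (D m) y \<partial>S)"
          by (rule nn_integral_shift) measurable
        then show "ennreal L * emeasure S (seq_shift i -` D m)
            = (\<integral>\<^sup>+y. ennreal L * indicator (D m) (seq_shift i y) \<partial>S)"
          by (simp add: nn_integral_cmult_indicator emeasure_shift)
      qed
      also have "\<dots> = (\<integral>\<^sup>+y. (\<Sum>i<N. ennreal L * indicator (D m) (seq_shift i y)) \<partial>S)"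
        by (rule nn_integral_sum[symmetric]) measurable
      also have "\<dots> \<le> (\<integral>\<^sup>+y. (\<Sum>j<N+m. Z (seq_shift j y)) \<partial>S)"
      proof (rule nn_integral_mono)
        fix y
        have "(\<Sum>i<N. ennreal L * indicator (D m) (seq_shift i y))
            = of_nat (card {i. i < N \<and> seq_shift i y \<in> D m}) * ennreal L"
          by (simp add: indicator_def of_bool_def if_distrib sum.If_cases Int_def cong: if_cong)
        also have "\<dots> \<le> (\<Sum>j<N+m. Z (seq_shift j y))"
          using card_heavy_windows[of N m "ennreal L" "\<lambda>j. Z (seq_shift j y)"]
          by (simp add: D_def shift_shift del: sum.lessThan_Suc)
        finally show "(\<Sum>i<N. ennreal L * indicator (D m) (seq_shift i y)) \<le> (\<Sum>j<N+m. Z (seq_shift j y))" .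
      qed
      also have "\<dots> = (\<Sum>j<N+m. \<integral>\<^sup>+y. Z (seq_shift j y) \<partial>S)"
        by (rule nn_integral_sum) measurable
      also have "\<dots> = of_nat (N + m) * ennreal e"
        by (simp add: nn_integral_shift e)
      finally have "ennreal (real N * L * measure S (D m)) \<le> ennreal (real (N + m) * e)"
        using L e by (simp add: P.emeasure_eq_measure ennreal_mult ennreal_of_nat_eq_real_of_nat del: of_nat_add)
      then have "real N * L * measure S (D m) \<le> real (N + m) * e"
        using e by (subst (asm) ennreal_le_iff) auto
      then show ?thesis using N by (simp add: field_simps)
    qed
    moreover have "(\<lambda>N. e + real m * e / real N) \<longlonglongrightarrow> e + 0"
      by (intro tendsto_intros lim_const_over_n)
    ultimately show ?thesis
      by (intro LIMSEQ_le_const[of _ e]) (auto intro!: exI[of _ 1])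
  qed
  \<comment> \<open>Continuity from below removes the restriction on the window length.\<close>
  have "incseq D" by (auto simp: D_def incseq_def) (meson less_le_trans)
  then have "(\<lambda>m. measure S (D m)) \<longlonglongrightarrow> measure S (\<Union>m. D m)"
    by (intro P.finite_Lim_measure_incseq) auto
  then have "L * measure S (\<Union>m. D m) \<le> e"
    using D by (intro LIMSEQ_le_const2[OF tendsto_mult_left]) auto
  moreover have "(\<Union>m. D m) = {y. \<exists>n. ennreal L * of_nat (Suc n) < (\<Sum>j<Suc n. Z (seq_shift j y))}"
    by (auto simp: D_def)
  ultimately show ?thesis
    using e L by (simp add: P.emeasure_eq_measure ennreal_leI flip: ennreal_mult)
qed simp

end

subsection \<open>Limits of future sums\<close>

context group_walk
begin

section \<open>The strong law for future sums\<close>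

lemma abs_returns_le: "n \<le> m \<Longrightarrow> \<bar>h (returns y n)\<bar> \<le> (\<Sum>k\<le>m. \<bar>h k\<bar>)" for h :: "nat \<Rightarrow> real"
  using returns_le[of y n] by (intro member_le_sum[of _ _ "\<lambda>k. \<bar>h k\<bar>"]) auto

lemma measurable_future_sum [measurable]: "future_sum h n \<in> borel_measurable S"
  unfolding future_sum_def by measurable

text \<open>With a fixed horizon, the \<open>i\<close>-th term depends only on the \<open>m\<close>
  steps following time \<open>i\<close>. The centred terms are therefore bounded and uncorrelated at
  distance at least \<open>m\<close>.\<close>

lemma AE_average_returns:
  "AE y in S. (\<lambda>n. (\<Sum>i<n. h (returns (seq_shift i y) m)) / real n)
    \<longlonglongrightarrow> (\<integral>y. h (returns y m) \<partial>S)"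
proof -
  define c where "c = (\<integral>y. h (returns y m) \<partial>S)"
  define C where "C = (\<Sum>k\<le>m. \<bar>h k\<bar>)"
  define g where "g y = h (returns y m) - c" for y :: "nat \<Rightarrow> 'b"
  have [measurable]: "g \<in> borel_measurable S" unfolding g_def by measurable
  have C: "\<bar>h (returns y m)\<bar> \<le> C" for y :: "nat \<Rightarrow> 'b"
    unfolding C_def by (rule abs_returns_le) simp
  have g: "\<bar>g y\<bar> \<le> C + \<bar>c\<bar>" for y
    using C[of y] by (simp add: g_def)
  have "integrable S (\<lambda>y. h (returns y m))"
    using C by (intro P.integrable_const_bound[where B = C]) auto
  then have g0: "(\<integral>y. g y \<partial>S) = 0"
    unfolding g_def using P.prob_space by (simp add: c_def)
  have "AE y in S. (\<lambda>n. (\<Sum>i<n. g (seq_shift i y)) / real n) \<longlonglongrightarrow> 0"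
  proof (rule P.average_tendsto_0_finite_range)
    fix i j assume ij: "i + m \<le> j"
    have "(\<integral>y. g (seq_shift i y) * g (seq_shift j y) \<partial>S)
      = (\<integral>y. (\<lambda>y. g y * g (seq_shift (j - i) y)) (seq_shift i y) \<partial>S)"
      using ij by (simp add: shift_shift)
    also have "\<dots> = (\<integral>y. g y * g (seq_shift (j - i) y) \<partial>S)"
      by (rule integral_shift) measurable
    also have "\<dots> = (\<integral>y. g y \<partial>S) * (\<integral>y. g y \<partial>S)"
    proof (rule integral_past_future)
      fix \<omega> \<omega>' :: "nat \<Rightarrow> 'b"
      have "returns (comb_seq (j - i) \<omega> \<omega>') m = returns \<omega> m"
        using ij by (intro returns_cong) (auto simp: comb_seq_def)
      then show "g (comb_seq (j - i) \<omega> \<omega>') = g \<omega>" by (simp add: g_def)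
    qed (use g in auto)
    finally show "(\<integral>y. g (seq_shift i y) * g (seq_shift j y) \<partial>S) = 0" by (simp add: g0)
  qed (use g in auto)
  then show ?thesis
  proof eventually_elim
    case (elim y)
    then have "(\<lambda>n. (\<Sum>i<n. g (seq_shift i y)) / real n + c) \<longlonglongrightarrow> 0 + c"
      by (intro tendsto_intros)
    moreover have "\<forall>\<^sub>F n in sequentially. (\<Sum>i<n. g (seq_shift i y)) / real n + c
        = (\<Sum>i<n. h (returns (seq_shift i y) m)) / real n"
      using eventually_gt_at_top[of 0]
      by eventually_elim (simp add: g_def sum_subtractf field_simps)
    ultimately show ?case
      by (simp add: c_def[symmetric] tendsto_cong)
  qed
qed

text \<open>One stationary quantity that bounds the error of replacing any horizon beyond
  \<open>m\<close> by \<open>m\<close>. Values in \<open>ennreal\<close> keep the supremum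
  meaningful on paths where it is infinite.\<close>

definition oscillation :: "(nat \<Rightarrow> real) \<Rightarrow> nat \<Rightarrow> (nat \<Rightarrow> 'b) \<Rightarrow> ennreal" where
  "oscillation h m y = (SUP n. ennreal \<bar>h (returns y (m + n)) - h (returns y m)\<bar>)"

lemma measurable_oscillation [measurable]: "oscillation h m \<in> borel_measurable S"
  unfolding oscillation_def by measurable

text \<open>A path violating the claim lies in \<open>Bad m\<close> for every
  \<open>m \<ge> m0\<close>. By the maximal inequality \<open>Bad m\<close> has probability at most
  the mean oscillation divided by \<open>L\<close>, which tends to 0. The \<open>m\<close> obtained
  depends on the path, but then serves all \<open>n\<close> at once.\<close>

lemma AE_small_oscillation_average:
  assumes "summable (\<lambda>k. \<bar>h k\<bar> * return_prob ^ k)" "return_prob < 1" and L: "0 < L"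
  shows "AE y in S. \<exists>m\<ge>m0. \<forall>n. (\<Sum>j<Suc n. oscillation h m (seq_shift j y)) \<le> ennreal L * of_nat (Suc n)"
proof -
  define Bad where
    "Bad m = {y. \<exists>n. ennreal L * of_nat (Suc n) < (\<Sum>j<Suc n. oscillation h m (seq_shift j y))}" for m
  have [measurable]: "Bad m \<in> sets S" for m
  proof -
    have "{y\<in>space S. \<exists>n. ennreal L * of_nat (Suc n) < (\<Sum>j<Suc n. oscillation h m (seq_shift j y))} \<in> sets S"
      by measurable
    then show ?thesis by (simp add: Bad_def)
  qed
  define N where "N = (\<Inter>m\<in>{m0..}. Bad m)"
  have [measurable]: "N \<in> sets S" unfolding N_def by measurable
  have "ennreal L * emeasure S N \<le> (\<integral>\<^sup>+y. oscillation h m y \<partial>S)" if "m \<ge> m0" for m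
  proof -
    have "ennreal L * emeasure S N \<le> ennreal L * emeasure S (Bad m)"
      using that by (intro mult_left_mono emeasure_mono) (auto simp: N_def)
    also have "\<dots> \<le> (\<integral>\<^sup>+y. oscillation h m y \<partial>S)"
      unfolding Bad_def by (rule maximal_inequality[OF _ L]) measurable
    finally show ?thesis .
  qed
  moreover have "(\<lambda>m. \<integral>\<^sup>+y. oscillation h m y \<partial>S) \<longlonglongrightarrow> 0"
    unfolding oscillation_def by (rule nn_integral_oscillation_tendsto_0[OF assms(1,2)])
  ultimately have "ennreal L * emeasure S N \<le> 0"
    by (intro LIMSEQ_le_const) auto
  then have "emeasure S N = 0" using L by simp
  then have "AE y in S. y \<notin> N"
    by (intro AE_not_in) (auto simp: null_sets_def)
  then show ?thesis
    by eventually_elim (auto simp: N_def Bad_def not_less)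
qed

text \<open>If \<open>i + m \<le> n\<close>, the true horizon \<open>n - i\<close> is at least
  \<open>m\<close> and the error is at most the oscillation. At most \<open>m\<close> indices
  remain; there both counts are at most \<open>m\<close>, so each error is at most twice the sum of
  the first \<open>m + 1\<close> values of \<open>\<bar>h k\<bar>\<close>.\<close>

lemma future_sum_approx:
  assumes "0 \<le> L"
    and osc: "(\<Sum>j<Suc n. oscillation h m (seq_shift j y)) \<le> ennreal L * of_nat (Suc n)"
  shows "\<bar>future_sum h n y - (\<Sum>i<Suc n. h (returns (seq_shift i y) m))\<bar>
    \<le> L * real (Suc n) + real m * (2 * (\<Sum>k\<le>m. \<bar>h k\<bar>))"
proof -
  define C where "C = (\<Sum>k\<le>m. \<bar>h k\<bar>)"
  define d where "d i = \<bar>h (returns (seq_shift i y) (n - i)) - h (returns (seq_shift i y) m)\<bar>" for i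
  have C0: "0 \<le> C" by (simp add: C_def sum_nonneg)
  have early: "ennreal (d i) \<le> oscillation h m (seq_shift i y)" if "i + m \<le> n" for i
    unfolding oscillation_def d_def using that by (intro SUP_upper2[of "n - i - m"]) auto
  have late: "d i \<le> 2 * C" if "i \<le> n" "\<not> i + m \<le> n" for i
    using abs_returns_le[of "n - i" m h "seq_shift i y"] abs_returns_le[of m m h "seq_shift i y"] that
    unfolding d_def C_def by linarith
  have "ennreal (\<Sum>i | i < Suc n \<and> i + m \<le> n. d i) = (\<Sum>i | i < Suc n \<and> i + m \<le> n. ennreal (d i))"
    by (intro sum_ennreal[symmetric]) (simp add: d_def)
  also have "\<dots> \<le> (\<Sum>i | i < Suc n \<and> i + m \<le> n. oscillation h m (seq_shift i y))"
    by (intro sum_mono early) auto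
  also have "\<dots> \<le> (\<Sum>j<Suc n. oscillation h m (seq_shift j y))"
    by (intro sum_mono2) auto
  also have "\<dots> \<le> ennreal (L * real (Suc n))"
    using osc assms(1) by (simp add: ennreal_mult ennreal_of_nat_eq_real_of_nat)
  finally have 1: "(\<Sum>i | i < Suc n \<and> i + m \<le> n. d i) \<le> L * real (Suc n)"
    using assms(1) by (subst (asm) ennreal_le_iff) auto
  have "(\<Sum>i | i < Suc n \<and> \<not> i + m \<le> n. d i) \<le> (\<Sum>i\<in>{Suc n - m..<Suc n}. 2 * C)"
  proof (rule order_trans[OF sum_mono])
    show "d i \<le> 2 * C" if "i \<in> {i. i < Suc n \<and> \<not> i + m \<le> n}" for i
      using that late by auto
    show "(\<Sum>i | i < Suc n \<and> \<not> i + m \<le> n. 2 * C) \<le> (\<Sum>i\<in>{Suc n - m..<Suc n}. 2 * C)"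
      using C0 by (intro sum_mono2) auto
  qed
  also have "\<dots> = real (Suc n - (Suc n - m)) * (2 * C)"
    by simp
  also have "\<dots> \<le> real m * (2 * C)"
    using C0 by (intro mult_right_mono) auto
  finally have 2: "(\<Sum>i | i < Suc n \<and> \<not> i + m \<le> n. d i) \<le> real m * (2 * C)" .
  have "{i. i < Suc n \<and> i + m \<le> n} \<union> {i. i < Suc n \<and> \<not> i + m \<le> n} = {..<Suc n}" by auto
  then have 3: "(\<Sum>i<Suc n. d i)
      = (\<Sum>i | i < Suc n \<and> i + m \<le> n. d i) + (\<Sum>i | i < Suc n \<and> \<not> i + m \<le> n. d i)"
    using sum.union_disjoint[of "{i. i < Suc n \<and> i + m \<le> n}" "{i. i < Suc n \<and> \<not> i + m \<le> n}" d] by auto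
  have "\<bar>future_sum h n y - (\<Sum>i<Suc n. h (returns (seq_shift i y) m))\<bar> \<le> (\<Sum>i<Suc n. d i)"
    unfolding future_sum_def d_def lessThan_Suc_atMost sum_subtractf[symmetric] by (rule sum_abs)
  then show ?thesis using 1 2 3 by (simp add: C_def)
qed

theorem AE_future_sum:
  assumes h: "summable (\<lambda>k. \<bar>h k\<bar> * return_prob ^ k)" and q: "return_prob < 1"
  shows "AE y in S. (\<lambda>n. future_sum h n y / real (Suc n))
    \<longlonglongrightarrow> (\<Sum>k. h k * (return_prob ^ k - return_prob ^ Suc k))"
proof -
  define c where "c = (\<Sum>k. h k * (return_prob ^ k - return_prob ^ Suc k))"
  define cm where "cm m = (\<integral>y. h (returns y m) \<partial>S)" for m
  have cm: "cm \<longlonglongrightarrow> c"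
    using integral_returns_tendsto[OF h] unfolding cm_def c_def .
  \<comment> \<open>Restricting the tolerances to \<open>1 / real (Suc p)\<close> leaves countably
    many conditions, so one null set suffices.\<close>
  have "AE y in S. \<forall>m. (\<lambda>n. (\<Sum>i<n. h (returns (seq_shift i y) m)) / real n) \<longlonglongrightarrow> cm m"
    unfolding AE_all_countable cm_def by (intro allI AE_average_returns)
  moreover have "AE y in S. \<forall>p m0. \<exists>m\<ge>m0. \<forall>n.
      (\<Sum>j<Suc n. oscillation h m (seq_shift j y)) \<le> ennreal (1 / real (Suc p)) * of_nat (Suc n)"
    unfolding AE_all_countable by (intro allI AE_small_oscillation_average h q) simp
  ultimately show ?thesis
  proof eventually_elim
    case (elim y)
    show ?case
      unfolding c_def[symmetric]
    proof (rule LIMSEQ_I)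
      fix r :: real assume r: "0 < r"
      \<comment> \<open>Four errors of size \<open>r / 4\<close>: the oscillation average, the final
        \<open>m\<close> indices, the fixed-horizon average against \<open>cm m\<close>, and
        \<open>cm m\<close> against \<open>c\<close>. The horizon \<open>m\<close> must follow
        \<open>p\<close> and \<open>m0\<close>, since it depends on the path.\<close>
      obtain p where p: "1 / real (Suc p) < r / 4"
        using reals_Archimedean[of "r / 4"] r by (auto simp: inverse_eq_divide)
      obtain m0 where m0: "\<And>m. m \<ge> m0 \<Longrightarrow> \<bar>cm m - c\<bar> < r / 4"
        using LIMSEQ_D[OF cm, of "r / 4"] r by auto
      obtain m where m: "m \<ge> m0" and osc: "\<And>n. (\<Sum>j<Suc n. oscillation h m (seq_shift j y))
          \<le> ennreal (1 / real (Suc p)) * of_nat (Suc n)"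
        using elim(2) by blast
      define C where "C = real m * (2 * (\<Sum>k\<le>m. \<bar>h k\<bar>))"
      define a where "a n = (\<Sum>i<n. h (returns (seq_shift i y) m)) / real n" for n
      have "(\<lambda>n. a (Suc n)) \<longlonglongrightarrow> cm m"
        using elim(1) unfolding a_def by (intro LIMSEQ_Suc) auto
      then obtain n1 where n1: "\<And>n. n \<ge> n1 \<Longrightarrow> \<bar>a (Suc n) - cm m\<bar> < r / 4"
        using LIMSEQ_D[of _ "cm m" "r / 4"] r by fastforce
      have "(\<lambda>n. C / real (Suc n)) \<longlonglongrightarrow> 0"
        by (intro LIMSEQ_Suc lim_const_over_n)
      then obtain n2 where n2: "\<And>n. n \<ge> n2 \<Longrightarrow> \<bar>C / real (Suc n)\<bar> < r / 4"
        using LIMSEQ_D[of _ 0 "r / 4"] r by fastforce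
      show "\<exists>no. \<forall>n\<ge>no. norm (future_sum h n y / real (Suc n) - c) < r"
      proof (intro exI allI impI)
        fix n assume n: "n \<ge> max n1 n2"
        have "\<bar>future_sum h n y - (\<Sum>i<Suc n. h (returns (seq_shift i y) m))\<bar> / real (Suc n)
            \<le> (1 / real (Suc p) * real (Suc n) + C) / real (Suc n)"
          unfolding C_def using osc by (intro divide_right_mono future_sum_approx) auto
        also have "\<dots> = 1 / real (Suc p) + C / real (Suc n)"
          by (simp add: add_divide_distrib del: of_nat_Suc)
        also have "\<bar>future_sum h n y - (\<Sum>i<Suc n. h (returns (seq_shift i y) m))\<bar> / real (Suc n)
            = \<bar>future_sum h n y / real (Suc n) - a (Suc n)\<bar>"
          unfolding a_def diff_divide_distrib[symmetric] abs_divide by simp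
        finally show "norm (future_sum h n y / real (Suc n) - c) < r"
          using p m0[OF m] n1[of n] n2[of n] n unfolding real_norm_def by linarith
      qed
    qed
  qed
qed

section \<open>Mean-square convergence of future sums\<close>

lemma abs_future_sum_le:
  assumes "\<And>k. k \<le> n \<Longrightarrow> \<bar>h k\<bar> \<le> B"
  shows "\<bar>future_sum h n y\<bar> \<le> B * real (Suc n)"
proof -
  have "\<bar>future_sum h n y\<bar> \<le> (\<Sum>i\<le>n. \<bar>h (returns (seq_shift i y) (n - i))\<bar>)"
    unfolding future_sum_def by (rule sum_abs)
  also have "\<dots> \<le> (\<Sum>i\<le>n. B)"
  proof (rule sum_mono)
    fix i
    have "returns (seq_shift i y) (n - i) \<le> n" using returns_le order_trans diff_le_self by blast
    then show "\<bar>h (returns (seq_shift i y) (n - i))\<bar> \<le> B" by (rule assms)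
  qed
  finally show ?thesis by (simp add: mult.commute)
qed

lemma integrable_future_sum_sq: "integrable S (\<lambda>y. (future_sum h n y / a - c)\<^sup>2)"
proof -
  define B where "B = (\<Sum>k\<le>n. \<bar>h k\<bar>) * real (Suc n)"
  have "\<bar>future_sum h n y\<bar> \<le> B" for y :: "nat \<Rightarrow> 'b"
    unfolding B_def by (intro abs_future_sum_le member_le_sum[of _ _ "\<lambda>k. \<bar>h k\<bar>"]) auto
  then have "\<bar>future_sum h n y / a - c\<bar> \<le> B / \<bar>a\<bar> + \<bar>c\<bar>" for y :: "nat \<Rightarrow> 'b"
    by (intro order_trans[OF abs_triangle_ineq4]) (auto intro!: divide_right_mono)
  then have "\<bar>future_sum h n y / a - c\<bar>\<^sup>2 \<le> (B / \<bar>a\<bar> + \<bar>c\<bar>)\<^sup>2" for y :: "nat \<Rightarrow> 'b"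
    by (intro power_mono) auto
  then show ?thesis
    by (intro P.integrable_const_bound[where B = "(B / \<bar>a\<bar> + \<bar>c\<bar>)\<^sup>2"]) auto
qed

text \<open>By Cauchy-Schwarz the squared average is at most the average of the squares. By
  stationarity each square has the mean of \<open>(h (returns y m))\<^sup>2\<close> for some
  \<open>m\<close>, which the geometric tails bound by the series. The bound is uniform in
  \<open>n\<close>, as the truncation argument requires.\<close>

lemma integral_future_sum_sq_le:
  assumes h: "summable (\<lambda>k. (h k)\<^sup>2 * return_prob ^ k)"
  shows "(\<integral>y. (future_sum h n y / real (Suc n))\<^sup>2 \<partial>S) \<le> (\<Sum>k. (h k)\<^sup>2 * return_prob ^ k)"
proof -
  let ?e = "\<Sum>k. (h k)\<^sup>2 * return_prob ^ k"
  have e0: "0 \<le> ?e" using return_prob_bounds by (intro suminf_nonneg h) auto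
  have int: "integrable S (\<lambda>y. (h (returns (seq_shift i y) m))\<^sup>2)" for i m
  proof -
    have "\<bar>h (returns (seq_shift i y) m)\<bar>\<^sup>2 \<le> (\<Sum>k\<le>m. \<bar>h k\<bar>)\<^sup>2" for y :: "nat \<Rightarrow> 'b"
      by (intro power_mono abs_returns_le) auto
    then show ?thesis
      by (intro P.integrable_const_bound[where B = "(\<Sum>k\<le>m. \<bar>h k\<bar>)\<^sup>2"]) auto
  qed
  have le: "(\<integral>y. (h (returns (seq_shift i y) m))\<^sup>2 \<partial>S) \<le> ?e" for i m
  proof -
    have "(\<integral>y. (h (returns (seq_shift i y) m))\<^sup>2 \<partial>S) = (\<integral>y. (h (returns y m))\<^sup>2 \<partial>S)"
      by (rule integral_shift) measurable
    moreover have "ennreal (\<integral>y. (h (returns y m))\<^sup>2 \<partial>S) \<le> ennreal ?e"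
    proof -
      have "ennreal (\<integral>y. (h (returns y m))\<^sup>2 \<partial>S) = (\<integral>\<^sup>+y. ennreal ((h (returns y m))\<^sup>2) \<partial>S)"
        using int[of 0 m] by (intro nn_integral_eq_integral[symmetric]) auto
      also have "\<dots> \<le> (\<Sum>k. ennreal ((h k)\<^sup>2) * ennreal (return_prob ^ k))"
        by (rule nn_integral_returns_le)
      also have "\<dots> = (\<Sum>k. ennreal ((h k)\<^sup>2 * return_prob ^ k))"
        using return_prob_bounds by (simp add: ennreal_mult)
      also have "\<dots> = ennreal ?e"
        using return_prob_bounds by (intro suminf_ennreal2 h) auto
      finally show ?thesis .
    qed
    ultimately show ?thesis using e0 by (simp add: ennreal_le_iff)
  qed
  have "(\<integral>y. (future_sum h n y / real (Suc n))\<^sup>2 \<partial>S)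
    \<le> (\<integral>y. (\<Sum>i\<le>n. (h (returns (seq_shift i y) (n - i)))\<^sup>2) / real (Suc n) \<partial>S)"
  proof (rule integral_mono)
    show "integrable S (\<lambda>y. (future_sum h n y / real (Suc n))\<^sup>2)"
      using integrable_future_sum_sq[of h n "real (Suc n)" 0] by simp
    fix y :: "nat \<Rightarrow> 'b"
    have "(future_sum h n y)\<^sup>2 \<le> (\<Sum>i\<le>n. (h (returns (seq_shift i y) (n - i)))\<^sup>2) * real (card {..n})"
      unfolding future_sum_def by (rule sum_squared_le_sum_of_squares)
    then show "(future_sum h n y / real (Suc n))\<^sup>2
        \<le> (\<Sum>i\<le>n. (h (returns (seq_shift i y) (n - i)))\<^sup>2) / real (Suc n)"
      by (simp add: power_divide power2_eq_square divide_simps mult.commute)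
  qed (simp add: int)
  also have "\<dots> = (\<Sum>i\<le>n. (\<integral>y. (h (returns (seq_shift i y) (n - i)))\<^sup>2 \<partial>S)) / real (Suc n)"
    by (simp add: int)
  also have "\<dots> \<le> (\<Sum>i\<le>n. ?e) / real (Suc n)"
    by (intro divide_right_mono sum_mono le) auto
  also have "\<dots> = ?e" by simp
  finally show ?thesis .
qed

text \<open>\<open>h\<close> is cut at \<open>K\<close> into \<open>t K\<close> and
  \<open>u K\<close>. The averages for \<open>t K\<close> are bounded, so their almost sure
  convergence gives convergence in mean square by dominated convergence. Those for
  \<open>u K\<close> have second moment at most the tail \<open>e K\<close> for every
  \<open>n\<close>, and the centring changes by \<open>cK K - c\<close>. First \<open>K\<close> is
  chosen, then \<open>n\<close>.\<close>

theorem mean_square_future_sum: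
  assumes h: "summable (\<lambda>k. \<bar>h k\<bar> * return_prob ^ k)" and q: "return_prob < 1"
    and h2: "summable (\<lambda>k. (h k)\<^sup>2 * return_prob ^ k)"
  shows "(\<lambda>n. \<integral>y. (future_sum h n y / real (Suc n)
      - (\<Sum>k. h k * (return_prob ^ k - return_prob ^ Suc k)))\<^sup>2 \<partial>S) \<longlonglongrightarrow> 0"
proof -
  define w where "w k = return_prob ^ k - return_prob ^ Suc k" for k
  define c where "c = (\<Sum>k. h k * w k)"
  define t where "t K k = (if k < K then h k else 0)" for K k
  define u where "u K k = (if k < K then 0 else h k)" for K k
  define cK where "cK K = (\<Sum>k<K. h k * w k)" for K
  define e where "e K = (\<Sum>k. (h k)\<^sup>2 * return_prob ^ k) - (\<Sum>k<K. (h k)\<^sup>2 * return_prob ^ k)" for K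
  have w: "0 \<le> w k" "w k \<le> return_prob ^ k" for k
    using return_prob_bounds power_decreasing[of k "Suc k" return_prob] by (auto simp: w_def)
  have "norm (h k * w k) \<le> \<bar>h k\<bar> * return_prob ^ k" for k
    using w[of k] by (auto simp: abs_mult intro!: mult_left_mono)
  then have "summable (\<lambda>k. h k * w k)"
    by (intro summable_comparison_test'[OF h]) auto
  then have cK: "cK \<longlonglongrightarrow> c"
    unfolding cK_def c_def by (rule summable_LIMSEQ)
  have e: "e \<longlonglongrightarrow> 0"
    using tendsto_diff[OF tendsto_const[of "\<Sum>k. (h k)\<^sup>2 * return_prob ^ k"] summable_LIMSEQ[OF h2]]
    unfolding e_def by simp
  have ct: "(\<Sum>k. t K k * w k) = cK K" for K
    unfolding cK_def by (subst suminf_finite[of "{..<K}"]) (auto simp: t_def)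
  have split: "future_sum h n y = future_sum (t K) n y + future_sum (u K) n y"
    for K n and y :: "nat \<Rightarrow> 'b"
    unfolding future_sum_def sum.distrib[symmetric] by (intro sum.cong) (auto simp: t_def u_def)
  have u_le: "(\<integral>y. (future_sum (u K) n y / real (Suc n))\<^sup>2 \<partial>S) \<le> e K" for K n
  proof -
    have "(\<lambda>k. (h k)\<^sup>2 * return_prob ^ k - (t K k)\<^sup>2 * return_prob ^ k) sums e K"
      unfolding e_def
    proof (intro sums_diff summable_sums h2)
      have "(\<lambda>k. (t K k)\<^sup>2 * return_prob ^ k) sums (\<Sum>k<K. (t K k)\<^sup>2 * return_prob ^ k)"
        by (rule sums_finite) (auto simp: t_def)
      then show "(\<lambda>k. (t K k)\<^sup>2 * return_prob ^ k) sums (\<Sum>k<K. (h k)\<^sup>2 * return_prob ^ k)"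
        by (simp add: t_def)
    qed
    moreover have "(h k)\<^sup>2 * return_prob ^ k - (t K k)\<^sup>2 * return_prob ^ k
        = (u K k)\<^sup>2 * return_prob ^ k" for k
      by (simp add: t_def u_def)
    ultimately have "(\<lambda>k. (u K k)\<^sup>2 * return_prob ^ k) sums e K" by simp
    then show ?thesis
      using integral_future_sum_sq_le[of "u K" n] by (simp add: sums_iff)
  qed
  have t_lim: "(\<lambda>n. \<integral>y. (future_sum (t K) n y / real (Suc n) - cK K)\<^sup>2 \<partial>S) \<longlonglongrightarrow> 0" for K
  proof -
    define B where "B = (\<Sum>k<K. \<bar>h k\<bar>)"
    have B: "\<bar>t K k\<bar> \<le> B" for k
      using member_le_sum[of k "{..<K}" "\<lambda>k. \<bar>h k\<bar>"] sum_nonneg[of "{..<K}" "\<lambda>k. \<bar>h k\<bar>"]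
      by (auto simp: t_def B_def)
    have "summable (\<lambda>k. \<bar>t K k\<bar> * return_prob ^ k)"
      by (rule summable_finite[of "{..<K}"]) (auto simp: t_def)
    from AE_future_sum[OF this q]
    have "AE y in S. (\<lambda>n. future_sum (t K) n y / real (Suc n)) \<longlonglongrightarrow> cK K"
      by (simp only: w_def[symmetric] ct)
    then have AE: "AE y in S. (\<lambda>n. (future_sum (t K) n y / real (Suc n) - cK K)\<^sup>2) \<longlonglongrightarrow> 0"
    proof eventually_elim
      case (elim y)
      then have "(\<lambda>n. (future_sum (t K) n y / real (Suc n) - cK K)\<^sup>2) \<longlonglongrightarrow> (cK K - cK K)\<^sup>2"
        by (intro tendsto_intros)
      then show ?case by simp
    qed
    have "(\<lambda>n. \<integral>y. (future_sum (t K) n y / real (Suc n) - cK K)\<^sup>2 \<partial>S) \<longlonglongrightarrow> (\<integral>y. 0 \<partial>S)"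
    proof (rule integral_dominated_convergence[where w = "\<lambda>_. (B + \<bar>cK K\<bar>)\<^sup>2"])
      fix n
      have "norm ((future_sum (t K) n y / real (Suc n) - cK K)\<^sup>2) \<le> (B + \<bar>cK K\<bar>)\<^sup>2"
        for y :: "nat \<Rightarrow> 'b"
      proof -
        have "\<bar>future_sum (t K) n y / real (Suc n)\<bar> \<le> B"
          using abs_future_sum_le[of n "t K" B y] B by (simp add: abs_divide divide_le_eq)
        then have "\<bar>future_sum (t K) n y / real (Suc n) - cK K\<bar> \<le> B + \<bar>cK K\<bar>"
          using abs_triangle_ineq4 order_trans add_right_mono by blast
        then have "\<bar>future_sum (t K) n y / real (Suc n) - cK K\<bar>\<^sup>2 \<le> (B + \<bar>cK K\<bar>)\<^sup>2"
          by (intro power_mono) auto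
        then show ?thesis by simp
      qed
      then show "AE y in S. norm ((future_sum (t K) n y / real (Suc n) - cK K)\<^sup>2) \<le> (B + \<bar>cK K\<bar>)\<^sup>2"
        by simp
    qed (use AE in auto)
    then show ?thesis by simp
  qed
  define I where "I = (\<lambda>n. \<integral>y. (future_sum h n y / real (Suc n) - c)\<^sup>2 \<partial>S)"
  \<comment> \<open>The difference of the two sides is the sum of the squares of the three pairwise
    differences.\<close>
  have three: "(a + b + d)\<^sup>2 \<le> 3 * a\<^sup>2 + 3 * b\<^sup>2 + 3 * d\<^sup>2" for a b d :: real
    using zero_le_power2[of "a - b"] zero_le_power2[of "a - d"] zero_le_power2[of "b - d"]
    by (simp add: power2_eq_square algebra_simps)
  have I_le: "I n \<le> 3 * (\<integral>y. (future_sum (t K) n y / real (Suc n) - cK K)\<^sup>2 \<partial>S)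
      + 3 * e K + 3 * (cK K - c)\<^sup>2" for K n
  proof -
    have intu: "integrable S (\<lambda>y. (future_sum (u K) n y / real (Suc n))\<^sup>2)"
      using integrable_future_sum_sq[of "u K" n "real (Suc n)" 0] by simp
    note int = integrable_future_sum_sq intu
    have "I n \<le> (\<integral>y. 3 * (future_sum (t K) n y / real (Suc n) - cK K)\<^sup>2
        + 3 * (future_sum (u K) n y / real (Suc n))\<^sup>2 + 3 * (cK K - c)\<^sup>2 \<partial>S)"
      unfolding I_def
    proof (rule integral_mono)
      fix y :: "nat \<Rightarrow> 'b"
      have "future_sum h n y / real (Suc n) - c = (future_sum (t K) n y / real (Suc n) - cK K)
          + future_sum (u K) n y / real (Suc n) + (cK K - c)"
        by (simp add: split[of n y K] add_divide_distrib)
      then show "(future_sum h n y / real (Suc n) - c)\<^sup>2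
        \<le> 3 * (future_sum (t K) n y / real (Suc n) - cK K)\<^sup>2
        + 3 * (future_sum (u K) n y / real (Suc n))\<^sup>2 + 3 * (cK K - c)\<^sup>2"
        by (simp only: three)
    qed (intro int Bochner_Integration.integrable_add integrable_mult_right integrable_const)+
    also have "\<dots> = 3 * (\<integral>y. (future_sum (t K) n y / real (Suc n) - cK K)\<^sup>2 \<partial>S)
      + 3 * (\<integral>y. (future_sum (u K) n y / real (Suc n))\<^sup>2 \<partial>S) + 3 * (cK K - c)\<^sup>2"
      using P.prob_space by (simp add: int del: of_nat_Suc)
    finally show ?thesis using u_le[of K n] by linarith
  qed
  have I0: "0 \<le> I n" for n by (simp add: I_def)
  have "I \<longlonglongrightarrow> 0"
  proof (rule LIMSEQ_I)
    fix r :: real assume r: "0 < r"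
    have "(\<lambda>K. 3 * e K + 3 * (cK K - c)\<^sup>2) \<longlonglongrightarrow> 3 * 0 + 3 * (c - c)\<^sup>2"
      by (intro tendsto_intros e cK)
    then obtain K where K: "3 * e K + 3 * (cK K - c)\<^sup>2 < r / 2"
      using order_tendstoD(2)[of _ _ sequentially "r / 2"] r
      by (fastforce simp: eventually_sequentially)
    have "(\<lambda>n. 3 * (\<integral>y. (future_sum (t K) n y / real (Suc n) - cK K)\<^sup>2 \<partial>S)) \<longlonglongrightarrow> 3 * 0"
      by (intro tendsto_intros t_lim)
    then have "\<forall>\<^sub>F n in sequentially. 3 * (\<integral>y. (future_sum (t K) n y / real (Suc n) - cK K)\<^sup>2 \<partial>S) < r / 2"
      by (rule order_tendstoD(2)) (use r in simp)
    then have "\<forall>\<^sub>F n in sequentially. norm (I n - 0) < r"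
    proof eventually_elim
      case (elim n)
      then show ?case using I_le[of n K] I0[of n] K unfolding real_norm_def by linarith
    qed
    then show "\<exists>no. \<forall>n\<ge>no. norm (I n - 0) < r" by (simp add: eventually_sequentially)
  qed
  then show ?thesis by (simp only: I_def c_def w_def)
qed

end

section \<open>From the canonical sequence space to the original probability space\<close>

subsection \<open>Transfer to the given walk\<close>

text \<open>Independence makes the joint law of the steps a product, and equal marginals make all
  factors \<open>\<mu>\<close>. Hence statements about \<open>S\<close> pull back along the step
  sequence. The index set \<open>{1..}\<close> is moved to all natural numbers through
  \<open>Suc\<close>.\<close>

lemma steps_distr:
  fixes X :: "nat \<Rightarrow> 'a \<Rightarrow> int ^ 'd::finite"
  assumes M: "prob_space M" and X: "iid_steps M X"
  defines "\<mu> \<equiv> distr M (count_space UNIV) (X 1)"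
  shows "(\<lambda>\<omega> n. X (Suc n) \<omega>) \<in> M \<rightarrow>\<^sub>M PiM UNIV (\<lambda>_::nat. \<mu>)"
    and "distr M (PiM UNIV (\<lambda>_. \<mu>)) (\<lambda>\<omega> n. X (Suc n) \<omega>) = PiM UNIV (\<lambda>_. \<mu>)"
    and "group_walk \<mu>"
proof -
  interpret prob_space M by fact
  have ind: "indep_vars (\<lambda>_. count_space UNIV) X {1..}"
    using X by (simp add: iid_steps_def)
  then have rv: "X (Suc n) \<in> M \<rightarrow>\<^sub>M count_space UNIV" for n
    by (auto simp: indep_vars_def)
  have "indep_vars (\<lambda>_. count_space UNIV) (\<lambda>n. X (Suc n)) UNIV"
    unfolding indep_vars_def2
  proof (intro conjI ballI indep_setsI)
    let ?F = "\<lambda>i. {X i -` A \<inter> space M |A. A \<in> sets (count_space UNIV)}"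
    fix A and J :: "nat set"
    assume J: "J \<noteq> {}" "J \<subseteq> UNIV" "finite J" "\<forall>j\<in>J. A j \<in> ?F (Suc j)"
    have "indep_sets ?F {1..}" using ind by (simp add: indep_vars_def2)
    then have "prob (\<Inter>i\<in>Suc ` J. A (i - 1)) = (\<Prod>i\<in>Suc ` J. prob (A (i - 1)))"
      using J by (intro indep_setsD[of ?F "{1..}"]) auto
    then show "prob (\<Inter>j\<in>J. A j) = (\<Prod>j\<in>J. prob (A j))"
      by (simp add: prod.reindex)
  qed (use rv in auto)
  then have "distr M (PiM UNIV (\<lambda>_. count_space UNIV)) (\<lambda>\<omega>. \<lambda>n\<in>UNIV. X (Suc n) \<omega>)
      = PiM UNIV (\<lambda>n. distr M (count_space UNIV) (X (Suc n)))"
    by (subst (asm) indep_vars_iff_distr_eq_PiM) (use rv in auto)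
  also have "(\<lambda>n. distr M (count_space UNIV) (X (Suc n))) = (\<lambda>_. \<mu>)"
  proof
    show "distr M (count_space UNIV) (X (Suc n)) = \<mu>" for n
      unfolding \<mu>_def by (rule X[unfolded iid_steps_def, THEN conjunct2, rule_format]) simp
  qed
  also have "distr M (PiM UNIV (\<lambda>_. count_space UNIV)) (\<lambda>\<omega>. \<lambda>n\<in>UNIV. X (Suc n) \<omega>)
      = distr M (PiM UNIV (\<lambda>_. \<mu>)) (\<lambda>\<omega> n. X (Suc n) \<omega>)"
    by (intro distr_cong sets_PiM_cong) (auto simp: \<mu>_def)
  finally show "distr M (PiM UNIV (\<lambda>_. \<mu>)) (\<lambda>\<omega> n. X (Suc n) \<omega>) = PiM UNIV (\<lambda>_. \<mu>)" .
  show "(\<lambda>\<omega> n. X (Suc n) \<omega>) \<in> M \<rightarrow>\<^sub>M PiM UNIV (\<lambda>_. \<mu>)"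
    using rv by (intro measurable_abs_UNIV) (simp add: \<mu>_def)
  have "prob_space \<mu>"
    unfolding \<mu>_def using rv[of 0] by (intro prob_space_distr) simp
  then interpret mu: product_prob_space "\<lambda>_. \<mu>" "UNIV :: nat set"
    by (rule product_prob_spaceI)
  show "group_walk \<mu>"
    by unfold_locales (simp add: \<mu>_def)
qed

lemma escape_prob_eq:
  fixes X :: "nat \<Rightarrow> 'a \<Rightarrow> int ^ 'd::finite"
  assumes M: "prob_space M" and X: "iid_steps M X"
  shows "escape_prob M X = 1 - group_walk.return_prob (distr M (count_space UNIV) (X 1))"
proof -
  define \<mu> where "\<mu> = distr M (count_space UNIV) (X 1)"
  define Y where "Y = (\<lambda>\<omega> n. X (Suc n) \<omega>)"
  note d = steps_distr[OF M X, folded \<mu>_def Y_def]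
  interpret group_walk \<mu> by (rule d(3))
  have walk: "walk X n \<omega> = psum (Y \<omega>) n" for n \<omega>
    unfolding walk_def psum_def Y_def
    by (rule sum.reindex_bij_witness[of _ Suc "\<lambda>i. i - 1"]) auto
  define R where "R = {y :: nat \<Rightarrow> int ^ 'd. \<exists>n\<ge>1. psum y n = 0}"
  have R: "R \<in> sets S"
  proof -
    have "{y\<in>space S. \<exists>n\<ge>1. psum y n = 0} \<in> sets S" by measurable
    then show ?thesis by (simp add: R_def)
  qed
  have "{\<omega> \<in> space M. \<forall>n\<ge>1. walk X n \<omega> \<noteq> 0} = Y -` (space S - R) \<inter> space M"
    by (auto simp: walk R_def)
  then have "escape_prob M X = measure (distr M S Y) (space S - R)"
    unfolding escape_prob_def using measure_distr[OF d(1) sets.compl_sets[OF R]] by simp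
  also have "\<dots> = 1 - return_prob"
    unfolding d(2) by (subst P.prob_compl[OF R]) (simp add: return_prob_def R_def)
  finally show ?thesis by (simp add: \<mu>_def)
qed

text \<open>Summability passes from \<open>f\<close> to its increments \<open>h\<close> through
  \<open>\<bar>x\<bar> \<le> 1 + x\<^sup>2\<close> and
  \<open>(x - y)\<^sup>2 \<le> 2 * (x\<^sup>2 + y\<^sup>2)\<close>. For the value, delaying
  \<open>f\<close> by one index multiplies its power series by \<open>q\<close>; so the series of
  \<open>h\<close> is \<open>(1 - q)\<close> times that of \<open>f\<close>, and the geometric
  weights supply the second factor \<open>1 - q\<close>.\<close>

lemma diff_weights_summable:
  fixes f h :: "nat \<Rightarrow> real" and q :: real
  assumes q: "0 < q" "q < 1"
    and f: "summable (\<lambda>j. (f (Suc j))\<^sup>2 * real (Suc j) * q ^ Suc j)"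
    and h_def: "\<And>k. h k = f (Suc k) - (if k = 0 then 0 else f k)"
  shows "summable (\<lambda>j. f (Suc j) * q ^ j)"
    and "summable (\<lambda>k. \<bar>h k\<bar> * q ^ k)"
    and "summable (\<lambda>k. (h k)\<^sup>2 * q ^ k)"
    and "(\<Sum>k. h k * (q ^ k - q ^ Suc k)) = (1 - q)\<^sup>2 * (\<Sum>j. f (Suc j) * q ^ j)"
proof -
  define g where "g k = (if k = 0 then 0 else f k)" for k
  have gS: "g (Suc k) = f (Suc k)" for k by (simp add: g_def)
  have h: "h k = f (Suc k) - g k" for k by (simp add: h_def g_def)
  have f2: "summable (\<lambda>j. (f (Suc j))\<^sup>2 * q ^ j)"
  proof (rule summable_comparison_test')
    \<comment> \<open>The factor \<open>1 / q\<close> compensates the index shift in the power;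
      \<open>real (Suc j)\<close> is at least 1.\<close>
    show "summable (\<lambda>j. 1 / q * ((f (Suc j))\<^sup>2 * real (Suc j) * q ^ Suc j))"
      by (intro summable_mult f)
    show "norm ((f (Suc j))\<^sup>2 * q ^ j) \<le> 1 / q * ((f (Suc j))\<^sup>2 * real (Suc j) * q ^ Suc j)" for j
    proof -
      have "(f (Suc j))\<^sup>2 * q ^ j * 1 \<le> (f (Suc j))\<^sup>2 * q ^ j * real (Suc j)"
        using q by (intro mult_left_mono) auto
      then show ?thesis using q by (simp add: field_simps)
    qed
  qed
  have f1: "summable (\<lambda>j. \<bar>f (Suc j)\<bar> * q ^ j)"
  proof (rule summable_comparison_test')
    show "summable (\<lambda>j. q ^ j + (f (Suc j))\<^sup>2 * q ^ j)"
      using q by (intro summable_add f2 summable_geometric) auto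
    show "norm (\<bar>f (Suc j)\<bar> * q ^ j) \<le> q ^ j + (f (Suc j))\<^sup>2 * q ^ j" for j
    proof -
      have "\<bar>f (Suc j)\<bar> \<le> 1 + (f (Suc j))\<^sup>2"
        using zero_le_power2[of "\<bar>f (Suc j)\<bar> - 1"] by (simp add: power2_eq_square algebra_simps)
      then have "\<bar>f (Suc j)\<bar> * q ^ j \<le> (1 + (f (Suc j))\<^sup>2) * q ^ j"
        using q by (intro mult_right_mono) auto
      then show ?thesis using q by (simp add: algebra_simps)
    qed
  qed
  show f: "summable (\<lambda>j. f (Suc j) * q ^ j)"
    by (rule summable_rabs_cancel) (use f1 q in \<open>simp add: abs_mult\<close>)
  have g1: "summable (\<lambda>k. \<bar>g k\<bar> * q ^ k)"
    by (subst summable_Suc_iff[symmetric])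
      (use summable_mult[OF f1, of q] in \<open>simp add: gS mult.left_commute\<close>)
  have g2: "summable (\<lambda>k. (g k)\<^sup>2 * q ^ k)"
    by (subst summable_Suc_iff[symmetric])
      (use summable_mult[OF f2, of q] in \<open>simp add: gS mult.left_commute\<close>)
  show "summable (\<lambda>k. \<bar>h k\<bar> * q ^ k)"
  proof (rule summable_comparison_test'[OF summable_add[OF f1 g1]])
    show "norm (\<bar>h k\<bar> * q ^ k) \<le> \<bar>f (Suc k)\<bar> * q ^ k + \<bar>g k\<bar> * q ^ k" for k
      using q by (simp add: h flip: distrib_right)
  qed
  show "summable (\<lambda>k. (h k)\<^sup>2 * q ^ k)"
  proof (rule summable_comparison_test'[OF summable_mult[OF summable_add[OF f2 g2], of 2]])
    fix k
    have "(h k)\<^sup>2 \<le> 2 * ((f (Suc k))\<^sup>2 + (g k)\<^sup>2)"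
      using zero_le_power2[of "f (Suc k) + g k"] by (simp add: h power2_eq_square algebra_simps)
    then have "(h k)\<^sup>2 * q ^ k \<le> 2 * ((f (Suc k))\<^sup>2 + (g k)\<^sup>2) * q ^ k"
      using q by (intro mult_right_mono) auto
    then show "norm ((h k)\<^sup>2 * q ^ k) \<le> 2 * ((f (Suc k))\<^sup>2 * q ^ k + (g k)\<^sup>2 * q ^ k)"
      using q by (simp add: algebra_simps)
  qed
  define F where "F = (\<Sum>j. f (Suc j) * q ^ j)"
  have F: "(\<lambda>j. f (Suc j) * q ^ j) sums F"
    using f by (simp add: F_def summable_sums)
  \<comment> \<open>Since \<open>g 0 = 0\<close>, adding the term at index 0 leaves this sum
    unchanged.\<close>
  have "(\<lambda>k. g (Suc k) * q ^ Suc k) sums (q * F)"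
    using sums_mult[OF F, of q] by (simp add: gS mult.left_commute)
  then have "(\<lambda>k. g k * q ^ k) sums (q * F)"
    by (subst (asm) sums_Suc_iff) (simp add: g_def)
  from sums_mult[OF sums_diff[OF F this], of "1 - q"]
  have "(\<lambda>k. h k * (q ^ k - q ^ Suc k)) sums ((1 - q) * (F - q * F))"
    by (simp add: h algebra_simps)
  then show "(\<Sum>k. h k * (q ^ k - q ^ Suc k)) = (1 - q)\<^sup>2 * (\<Sum>j. f (Suc j) * q ^ j)"
    unfolding F_def by (simp add: sums_iff power2_eq_square algebra_simps)
qed

theorem theorem1:
  fixes M :: "'a measure"
    and X :: "nat \<Rightarrow> 'a \<Rightarrow> int ^ 'd::finite"
    and f :: "nat \<Rightarrow> real"
    and \<gamma> :: real
  defines "\<gamma> \<equiv> escape_prob M X"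
  assumes "prob_space M"
    and "iid_steps M X"
    and "transient M X"
    and "\<gamma> < 1"
    and "summable (\<lambda>j. (f (Suc j))\<^sup>2 * real (Suc j) * (1 - \<gamma>) ^ Suc j)"
  shows "summable (\<lambda>j. f (Suc j) * (1 - \<gamma>) ^ j)
    \<and> tendsto_mean_square M (\<lambda>n \<omega>. G X f n \<omega> / real n)
        (\<gamma>\<^sup>2 * (\<Sum>j. f (Suc j) * (1 - \<gamma>) ^ j))
    \<and> (AE \<omega> in M. (\<lambda>n. G X f n \<omega> / real n)
        \<longlonglongrightarrow> \<gamma>\<^sup>2 * (\<Sum>j. f (Suc j) * (1 - \<gamma>) ^ j))"
proof -
  define \<mu> where "\<mu> = distr M (count_space UNIV) (X 1)"
  define Y where "Y = (\<lambda>\<omega> n. X (Suc n) \<omega>)"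
  define h where "h = (\<lambda>k. f (Suc k) - (if k = 0 then 0 else f k))"
  note d = steps_distr[OF assms(2,3), folded \<mu>_def Y_def]
  interpret group_walk \<mu> by (rule d(3))
  have Y [measurable]: "Y \<in> M \<rightarrow>\<^sub>M S" by (rule d(1))
  have \<gamma>: "\<gamma> = 1 - return_prob"
    unfolding \<gamma>_def \<mu>_def by (rule escape_prob_eq[OF assms(2,3)])
  have q: "0 < return_prob" "return_prob < 1"
    using assms(4,5) \<gamma> by (simp_all add: transient_def flip: \<gamma>_def)
  define c where "c = \<gamma>\<^sup>2 * (\<Sum>j. f (Suc j) * (1 - \<gamma>) ^ j)"
  have "summable (\<lambda>j. (f (Suc j))\<^sup>2 * real (Suc j) * return_prob ^ Suc j)"
    using assms(6) by (simp add: \<gamma>)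
  note w = diff_weights_summable[OF q this fun_cong[OF h_def]]
  have c: "(\<Sum>k. h k * (return_prob ^ k - return_prob ^ Suc k)) = c"
    using w(4) by (simp add: c_def \<gamma> del: power_Suc)
  have G: "G X f n \<omega> = future_sum h n (Y \<omega>)" for n \<omega>
    unfolding h_def Y_def by (rule G_eq_future_sum)
  have "AE y in distr M S Y. (\<lambda>n. future_sum h n y / real (Suc n)) \<longlonglongrightarrow> c"
    unfolding d(2) using AE_future_sum[OF w(2) q(2)] unfolding c .
  then have "AE \<omega> in M. (\<lambda>n. future_sum h n (Y \<omega>) / real (Suc n)) \<longlonglongrightarrow> c"
    by (rule AE_distrD[OF Y])
  then have AE: "AE \<omega> in M. (\<lambda>n. G X f n \<omega> / real n) \<longlonglongrightarrow> c"
  proof eventually_elim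
    case (elim \<omega>)
    \<comment> \<open>There are \<open>Suc n\<close> times up to \<open>n\<close>, whereas the claim
      divides by \<open>n\<close>; the factor \<open>Suc n / n\<close> tends to 1.\<close>
    from tendsto_mult[OF this LIMSEQ_Suc_n_over_n]
    show ?case by (simp add: G del: of_nat_Suc)
  qed
  define I where "I = (\<lambda>n. \<integral>y. (future_sum h n y / real (Suc n) - c)\<^sup>2 \<partial>S)"
  have I: "I \<longlonglongrightarrow> 0"
    unfolding I_def using mean_square_future_sum[OF w(2) q(2) w(3)] unfolding c .
  have int: "integrable M (\<lambda>\<omega>. (G X f n \<omega> / a - b)\<^sup>2)" for n a b
  proof -
    have "integrable (distr M S Y) (\<lambda>y. (future_sum h n y / a - b)\<^sup>2)"
      unfolding d(2) by (rule integrable_future_sum_sq)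
    then show ?thesis unfolding G by (rule integrable_distr[OF Y])
  qed
  have "(\<lambda>n. \<integral>\<omega>. (G X f n \<omega> / real n - c)\<^sup>2 \<partial>M) \<longlonglongrightarrow> 0"
  proof (rule Lim_null_comparison)
    \<comment> \<open>Changing the normalisation writes the deviation as \<open>Suc n / n\<close>
      times the one for division by \<open>Suc n\<close>, plus \<open>c / n\<close>. The factors 2
      come from \<open>(a + b)\<^sup>2 \<le> 2 * a\<^sup>2 + 2 * b\<^sup>2\<close>.\<close>
    define e where "e n = 2 * (real (Suc n) / real n)\<^sup>2 * I n + 2 * (c / real n)\<^sup>2" for n
    have "e \<longlonglongrightarrow> 2 * 1\<^sup>2 * 0 + 2 * 0\<^sup>2"
      unfolding e_def by (intro tendsto_intros I LIMSEQ_Suc_n_over_n lim_const_over_n)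
    then show "e \<longlonglongrightarrow> 0" by simp
    show "\<forall>\<^sub>F n in sequentially. norm (\<integral>\<omega>. (G X f n \<omega> / real n - c)\<^sup>2 \<partial>M) \<le> e n"
      using eventually_gt_at_top[of 0]
    proof eventually_elim
      case (elim n)
      have "(\<integral>\<omega>. (G X f n \<omega> / real n - c)\<^sup>2 \<partial>M)
          = (\<integral>y. (future_sum h n y / real n - c)\<^sup>2 \<partial>distr M S Y)"
        unfolding G by (rule integral_distr[OF Y, symmetric]) measurable
      also have "\<dots> = (\<integral>y. (future_sum h n y / real n - c)\<^sup>2 \<partial>S)"
        by (simp add: d(2))
      also have "\<dots> \<le> (\<integral>y. 2 * (real (Suc n) / real n)\<^sup>2 * (future_sum h n y / real (Suc n) - c)\<^sup>2
          + 2 * (c / real n)\<^sup>2 \<partial>S)"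
      proof (rule integral_mono)
        fix y :: "nat \<Rightarrow> int ^ 'd"
        define a where "a = real (Suc n) / real n * (future_sum h n y / real (Suc n) - c)"
        have "a = future_sum h n y / real n - real (Suc n) / real n * c"
          by (simp add: a_def right_diff_distrib del: of_nat_Suc)
        moreover have "real (Suc n) / real n * c = c + c / real n"
          using elim by (simp add: field_simps)
        ultimately have "future_sum h n y / real n - c = a + c / real n" by simp
        moreover have "(a + b)\<^sup>2 \<le> 2 * a\<^sup>2 + 2 * b\<^sup>2" for b
          using zero_le_power2[of "a - b"] by (simp add: power2_eq_square algebra_simps)
        ultimately show "(future_sum h n y / real n - c)\<^sup>2
          \<le> 2 * (real (Suc n) / real n)\<^sup>2 * (future_sum h n y / real (Suc n) - c)\<^sup>2
            + 2 * (c / real n)\<^sup>2"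
          by (simp only: a_def power_mult_distrib mult.assoc)
      qed (intro integrable_future_sum_sq Bochner_Integration.integrable_add
          integrable_mult_right integrable_const)+
      also have "\<dots> = e n"
        using P.prob_space integrable_future_sum_sq
        by (simp add: e_def I_def del: of_nat_Suc)
      finally show ?case by simp
    qed
  qed
  moreover have "(\<lambda>\<omega>. G X f n \<omega> / real n) \<in> borel_measurable M" for n
    unfolding G by measurable
  moreover have "integrable M (\<lambda>\<omega>. (G X f n \<omega> / real n)\<^sup>2)" for n
    using int[of n "real n" 0] by simp
  ultimately have "tendsto_mean_square M (\<lambda>n \<omega>. G X f n \<omega> / real n) c"
    by (simp add: tendsto_mean_square_def)
  moreover have "summable (\<lambda>j. f (Suc j) * (1 - \<gamma>) ^ j)"
    using w(1) by (simp add: \<gamma>)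
  ultimately show ?thesis
    unfolding c_def[symmetric] using AE by blast
qed

end
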